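(* Let $G$ be a finite $k$-regular partial cube with girth $g(G)=6$. Then the following are equivalent: (a) every convex cycle of $G$ is a $6$-cycle; (b) every $3$-path of $G$ is contained in a $6$-cycle of $G$; (c) $G\cong\tilde{O}_k$.
   Context: A partial cube is a connected graph isomorphic to an isometric subgraph of a hypercube. A subgraph $H$ is convex if for all $u,v\in V(H)$ every shortest $u,v$-path of $G$ lies in $H$; a convex cycle is a cycle that is a convex subgraph. The girth $g(G)$ is the length of a shortest cycle. An $l$-path ($l$-cycle) is a path (cycle) with $l$ edges; a path is contained in a cycle if it is a subpath of it. For $k\geqslant 1$, the Doubled Odd graph $\tilde{O}_k$ is the bipartite graph whose two parts are the $(k-1)$-element subsets and the $k$-element subsets of $\{1,\dots,2k-1\}$, with a $(k-1)$-subset $u$ adjacent to a $k$-subset $v$ iff $u\subset v$. *)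

theory Defs
  imports Main
begin

definition graph :: "'a set \<Rightarrow> ('a \<Rightarrow> 'a \<Rightarrow> bool) \<Rightarrow> bool" where
  "graph V E \<longleftrightarrow> (\<forall>u v. E u v \<longrightarrow> u \<in> V \<and> v \<in> V \<and> E v u \<and> u \<noteq> v)"

definition walk :: "'a set \<Rightarrow> ('a \<Rightarrow> 'a \<Rightarrow> bool) \<Rightarrow> 'a list \<Rightarrow> bool" where
  "walk V E xs \<longleftrightarrow> xs \<noteq> [] \<and> set xs \<subseteq> V \<and> (\<forall>i. Suc i < length xs \<longrightarrow> E (xs ! i) (xs ! Suc i))"

text \<open>A path: a walk without repeated vertices; it has length xs - 1 edges.\<close>
definition gpath :: "'a set \<Rightarrow> ('a \<Rightarrow> 'a \<Rightarrow> bool) \<Rightarrow> 'a list \<Rightarrow> bool" where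
  "gpath V E xs \<longleftrightarrow> walk V E xs \<and> distinct xs"

definition gcycle :: "'a set \<Rightarrow> ('a \<Rightarrow> 'a \<Rightarrow> bool) \<Rightarrow> 'a list \<Rightarrow> bool" where
  "gcycle V E cs \<longleftrightarrow> length cs \<ge> 3 \<and> distinct cs \<and> set cs \<subseteq> V \<and>
     (\<forall>i < length cs. E (cs ! i) (cs ! ((i + 1) mod length cs)))"

definition cycle_edge :: "'a list \<Rightarrow> 'a \<Rightarrow> 'a \<Rightarrow> bool" where
  "cycle_edge cs x y \<longleftrightarrow> (\<exists>i < length cs.
     (x = cs ! i \<and> y = cs ! ((i + 1) mod length cs)) \<or>
     (y = cs ! i \<and> x = cs ! ((i + 1) mod length cs)))"

definition connected_graph :: "'a set \<Rightarrow> ('a \<Rightarrow> 'a \<Rightarrow> bool) \<Rightarrow> bool" where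
  "connected_graph V E \<longleftrightarrow> V \<noteq> {} \<and>
     (\<forall>u\<in>V. \<forall>v\<in>V. \<exists>xs. walk V E xs \<and> hd xs = u \<and> last xs = v)"

definition gdist :: "'a set \<Rightarrow> ('a \<Rightarrow> 'a \<Rightarrow> bool) \<Rightarrow> 'a \<Rightarrow> 'a \<Rightarrow> nat" where
  "gdist V E u v = (LEAST n. \<exists>xs. walk V E xs \<and> hd xs = u \<and> last xs = v \<and> length xs = Suc n)"

definition shortest_path :: "'a set \<Rightarrow> ('a \<Rightarrow> 'a \<Rightarrow> bool) \<Rightarrow> 'a \<Rightarrow> 'a \<Rightarrow> 'a list \<Rightarrow> bool" where
  "shortest_path V E u v xs \<longleftrightarrow> walk V E xs \<and> hd xs = u \<and> last xs = v \<and>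
     length xs = Suc (gdist V E u v)"

definition convex_cycle :: "'a set \<Rightarrow> ('a \<Rightarrow> 'a \<Rightarrow> bool) \<Rightarrow> 'a list \<Rightarrow> bool" where
  "convex_cycle V E cs \<longleftrightarrow> gcycle V E cs \<and>
     (\<forall>u\<in>set cs. \<forall>v\<in>set cs. \<forall>xs. shortest_path V E u v xs \<longrightarrow>
        set xs \<subseteq> set cs \<and> (\<forall>i. Suc i < length xs \<longrightarrow> cycle_edge cs (xs ! i) (xs ! Suc i)))"

definition girth :: "'a set \<Rightarrow> ('a \<Rightarrow> 'a \<Rightarrow> bool) \<Rightarrow> nat" where
  "girth V E = (if \<exists>cs. gcycle V E cs then LEAST l. \<exists>cs. gcycle V E cs \<and> length cs = l else 0)"

definition path_in_cycle :: "'a list \<Rightarrow> 'a list \<Rightarrow> bool" where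
  "path_in_cycle p cs \<longleftrightarrow> length p \<le> length cs \<and>
     (\<exists>i. take (length p) (rotate i cs) = p \<or> take (length p) (rotate i (rev cs)) = p)"

definition regular :: "'a set \<Rightarrow> ('a \<Rightarrow> 'a \<Rightarrow> bool) \<Rightarrow> nat \<Rightarrow> bool" where
  "regular V E k \<longleftrightarrow> (\<forall>v\<in>V. card {u \<in> V. E v u} = k)"

definition graph_iso :: "'a set \<Rightarrow> ('a \<Rightarrow> 'a \<Rightarrow> bool) \<Rightarrow> 'b set \<Rightarrow> ('b \<Rightarrow> 'b \<Rightarrow> bool) \<Rightarrow> bool" where
  "graph_iso V E W F \<longleftrightarrow> (\<exists>f. bij_betw f V W \<and> (\<forall>u\<in>V. \<forall>v\<in>V. E u v \<longleftrightarrow> F (f u) (f v)))"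

definition hcube_V :: "nat \<Rightarrow> nat set set" where
  "hcube_V n = Pow {..<n}"

definition hcube_E :: "nat \<Rightarrow> nat set \<Rightarrow> nat set \<Rightarrow> bool" where
  "hcube_E n A B \<longleftrightarrow> A \<in> hcube_V n \<and> B \<in> hcube_V n \<and> card ((A - B) \<union> (B - A)) = 1"

text \<open>Partial cube: connected graph isomorphic to an isometric subgraph of a hypercube,
  i.e. there is an isomorphism f onto a subgraph H of Q_n (vertex set f ` V, edges the
  images of edges of G, which must be edges of Q_n) with d_H = d_{Q_n} on H.\<close>
definition partial_cube :: "'a set \<Rightarrow> ('a \<Rightarrow> 'a \<Rightarrow> bool) \<Rightarrow> bool" where
  "partial_cube V E \<longleftrightarrow> connected_graph V E \<and>
     (\<exists>n f. inj_on f V \<and> f ` V \<subseteq> hcube_V n \<and>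
        (\<forall>u\<in>V. \<forall>v\<in>V. E u v \<longrightarrow> hcube_E n (f u) (f v)) \<and>
        (let HV = f ` V; HE = (\<lambda>a b. \<exists>u\<in>V. \<exists>v\<in>V. E u v \<and> a = f u \<and> b = f v) in
          \<forall>a\<in>HV. \<forall>b\<in>HV. gdist HV HE a b = gdist (hcube_V n) (hcube_E n) a b))"

definition dodd_V :: "nat \<Rightarrow> nat set set" where
  "dodd_V k = {A. A \<subseteq> {1..<2*k} \<and> (card A = k - 1 \<or> card A = k)}"

definition dodd_E :: "nat \<Rightarrow> nat set \<Rightarrow> nat set \<Rightarrow> bool" where
  "dodd_E k A B \<longleftrightarrow> A \<in> dodd_V k \<and> B \<in> dodd_V k \<and>
     ((card A = k - 1 \<and> card B = k \<and> A \<subset> B) \<or> (card B = k - 1 \<and> card A = k \<and> B \<subset> A))"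

end

theory Submission
  imports Defs
begin

text \<open>
  The implications proved are (a) to (c) to (b) to (a). For (a) to (c), identify vertices with sets, so
  that an edge flips one coordinate, its label. Girth 6 excludes squares. By induction on the distance
  from \<open>u\<close> to \<open>v\<close>, two edges at \<open>u\<close> that both lead towards \<open>v\<close> belong to a hexagon inside the interval:
  a shortest violation would make the interval a convex cycle longer than 6. Consequently the edges of a
  fixed label are linked by chains of hexagons (\<open>zone_step\<close>). At an endpoint \<open>x\<close> in a smallest halfspace
  of an edge crossing its boundary, this forces all neighbours of \<open>x\<close> to see the same labels other than
  the one leading back to \<open>x\<close>. By regularity the property passes to the neighbours, hence to all vertices,
  and it determines the graph.

  For (b) to (a), a hexagon through three consecutive edges of a convex cycle closes up with a geodesic,
  which convexity puts into the cycle.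
\<close>

section \<open>Isometric families of sets\<close>

text \<open>One device recurs: two vertices at distance 2 have a common neighbour among two
  candidates (\<open>two_step\<close>); if one candidate would complete a square, the other must
  exist. Closing a fork and carrying a label along hexagons depend on each other:
  \<open>zone_step\<close> consumes closed forks, and closing a long fork needs
  \<open>zone_step\<close>. The bound \<open>n\<close> in \<open>forks_close\<close> breaks the
  circle, since a fork at distance \<open>n\<close> only calls for label transport at the level
  \<open>n - 1\<close>. Transport needs a target edge with the same label. Near \<open>u\<close> and
  \<open>v\<close> the interval provides one; in the global part it comes from the minimality of the
  halfspace. Transport yields inclusions between label sets only. Regularity makes them equalities,
  because all the sets compared have \<open>k - 1\<close> elements. The ground set of size
  \<open>2 * k - 1\<close> consists of the \<open>k\<close> labels at one vertex and the
  \<open>k - 1\<close> further labels common to its neighbours.\<close>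

definition flip :: "'b set \<Rightarrow> 'b \<Rightarrow> 'b set" where
  "flip u c = {x. (x \<in> u) \<noteq> (x = c)}"

definition sdiff :: "'b set \<Rightarrow> 'b set \<Rightarrow> 'b set" where
  "sdiff u v = {x. (x \<in> u) \<noteq> (x \<in> v)}"

lemma mem_flip [simp]: "x \<in> flip u c \<longleftrightarrow> (x \<in> u) \<noteq> (x = c)"
  by (simp add: flip_def)

lemma mem_sdiff [simp]: "x \<in> sdiff u v \<longleftrightarrow> (x \<in> u) \<noteq> (x \<in> v)"
  by (simp add: sdiff_def)

lemma flip_flip [simp]: "flip (flip u c) c = u"
  by auto

lemma flip_commute: "flip (flip u c) d = flip (flip u d) c"
  by auto

lemma flip_inject [simp]: "flip u c = flip u d \<longleftrightarrow> c = d"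
  by (auto simp: set_eq_iff)

lemma flip_neq [simp]: "flip u c \<noteq> u" "u \<noteq> flip u c"
  by (auto simp: set_eq_iff)

lemma sdiff_commute: "sdiff u v = sdiff v u"
  by auto

lemma sdiff_self [simp]: "sdiff u u = {}"
  by auto

lemma sdiff_empty_iff [simp]: "sdiff u v = {} \<longleftrightarrow> u = v"
  by auto

lemma sdiff_flip [simp]: "sdiff u (flip u c) = {c}" "sdiff (flip u c) u = {c}"
  by auto

lemma flip_eq_iff: "flip u c = v \<longleftrightarrow> sdiff u v = {c}"
  by (auto simp: set_eq_iff)

lemma sdiff_flip_left: "sdiff (flip u c) v = flip (sdiff u v) c"
  by auto

lemma sdiff_flip_right: "sdiff u (flip v c) = flip (sdiff u v) c"
  by auto

lemma flip_mem: "c \<in> u \<Longrightarrow> flip u c = u - {c}"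
  by auto

lemma flip_notmem: "c \<notin> u \<Longrightarrow> flip u c = insert c u"
  by auto

lemma finite_sdiff: "finite u \<Longrightarrow> finite v \<Longrightarrow> finite (sdiff u v)"
  by (rule finite_subset[of _ "u \<union> v"]) auto

text \<open>Adjacency of the subgraph of the hypercube induced on \<open>N\<close>.\<close>

definition cube_adj :: "'b set set \<Rightarrow> 'b set \<Rightarrow> 'b set \<Rightarrow> bool" where
  "cube_adj N u v \<longleftrightarrow> u \<in> N \<and> v \<in> N \<and> card (sdiff u v) = 1"

lemma cube_adj_iff_flip: "cube_adj N u v \<longleftrightarrow> u \<in> N \<and> v \<in> N \<and> (\<exists>c. v = flip u c)"
  unfolding cube_adj_def by (metis card_1_singletonE flip_eq_iff is_singletonI is_singleton_altdef)

lemma cube_adj_flip: "u \<in> N \<Longrightarrow> flip u c \<in> N \<Longrightarrow> cube_adj N u (flip u c)"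
  by (auto simp: cube_adj_iff_flip)

definition labels :: "'b set set \<Rightarrow> 'b set \<Rightarrow> 'b set" where
  "labels N u = {c. flip u c \<in> N}"

text \<open>Two new vertices suffice to describe a hexagon at \<open>u\<close>: in an isometric
  family without squares, \<open>e\<close> differs from \<open>c\<close> and \<open>d\<close>, and
  the sixth vertex follows from \<open>two_step\<close>. The bound \<open>n\<close> allows the
  property to be an induction hypothesis.\<close>

definition forks_close :: "'b set set \<Rightarrow> nat \<Rightarrow> bool" where
  "forks_close N n \<longleftrightarrow> (\<forall>u v c d. u \<in> N \<and> v \<in> N \<and> card (sdiff u v) \<le> n \<and>
     c \<in> sdiff u v \<and> d \<in> sdiff u v \<and> c \<noteq> d \<and> flip u c \<in> N \<and> flip u d \<in> N \<longrightarrow>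
     (\<exists>e\<in>sdiff u v. flip (flip u c) e \<in> N \<and> flip (flip u d) e \<in> N))"

text \<open>\<open>isometric\<close> gives just the first edge of a geodesic; the rest follows by
  induction on the Hamming distance. \<open>no_square\<close> is the form in which girth 6
  enters.\<close>

locale isometric_family =
  fixes N :: "'b set set"
  assumes finite_family: "finite N"
    and finite_member: "u \<in> N \<Longrightarrow> finite u"
    and isometric: "u \<in> N \<Longrightarrow> v \<in> N \<Longrightarrow> u \<noteq> v \<Longrightarrow> \<exists>c\<in>sdiff u v. flip u c \<in> N"
    and no_square: "u \<in> N \<Longrightarrow> flip u c \<in> N \<Longrightarrow> flip u d \<in> N \<Longrightarrow>
      flip (flip u c) d \<in> N \<Longrightarrow> c = d"
begin

section \<open>Carrying a label along a chain of hexagons\<close>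

lemma finite_diff: "u \<in> N \<Longrightarrow> v \<in> N \<Longrightarrow> finite (sdiff u v)"
  by (simp add: finite_sdiff finite_member)

lemma two_step:
  assumes "p \<in> N" "flip (flip p c) d \<in> N" "c \<noteq> d"
  shows "flip p c \<in> N \<or> flip p d \<in> N"
proof -
  have "sdiff p (flip (flip p c) d) = {c, d}" using assms(3) by auto
  moreover from this have "p \<noteq> flip (flip p c) d" by (metis insert_not_empty sdiff_self)
  ultimately show ?thesis using isometric[OF assms(1,2)] by auto
qed

text \<open>The edge labelled \<open>a\<close> is carried from \<open>flip w c\<close> to
  \<open>flip w l\<close>, as the opposite edge of a hexagon with labels \<open>c\<close>,
  \<open>l\<close>, \<open>a\<close> in cyclic order. The edge at \<open>z\<close> is the target: it
  makes \<open>c\<close> and \<open>a\<close> a fork at \<open>flip w c\<close> towards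
  \<open>flip z a\<close>. This fork is two labels longer than the way from \<open>w\<close> to
  \<open>z\<close>, hence the \<open>+ 2\<close>.\<close>

lemma zone_step:
  assumes "forks_close N n"
  shows "w \<in> N \<Longrightarrow> flip w c \<in> N \<Longrightarrow> c \<notin> sdiff w z \<Longrightarrow> c \<noteq> a \<Longrightarrow> flip (flip w c) a \<in> N \<Longrightarrow>
    z \<in> N \<Longrightarrow> flip z a \<in> N \<Longrightarrow> l \<in> sdiff w z \<Longrightarrow> flip w l \<in> N \<Longrightarrow> a \<notin> sdiff w z \<Longrightarrow>
    card (sdiff w z) + 2 \<le> n \<Longrightarrow> flip (flip w l) a \<in> N"
proof (induction "card (sdiff w z)" arbitrary: w c l rule: less_induct)
  case (less w c l)
  note pr = less.prems
  let ?x = "flip w c"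
  have fin: "finite (sdiff w z)" using finite_diff pr by blast
  have "sdiff ?x (flip z a) = insert a (insert c (sdiff w z))"
    using pr(3,4,10) by auto
  hence card1: "card (sdiff ?x (flip z a)) \<le> n"
    using pr(11) card_insert_le_m1 fin by (simp add: card_insert_if)
  have "\<exists>e\<in>sdiff ?x (flip z a). flip (flip ?x c) e \<in> N \<and> flip (flip ?x a) e \<in> N"
    using assms[unfolded forks_close_def, rule_format, of ?x "flip z a" c a] pr card1 by auto
  then obtain e where e: "e \<in> sdiff ?x (flip z a)" "flip w e \<in> N" "flip (flip ?x a) e \<in> N"
    by auto
  have eca: "e \<noteq> c" "e \<noteq> a"
    using no_square[of ?x c a] no_square[of ?x a c] pr e by (auto simp: flip_commute)
  have ew: "e \<in> sdiff w z" using e(1) eca by auto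
  have xe: "flip ?x e \<notin> N"
    using no_square[of w c e] pr e eca by auto
  have wea: "flip (flip w e) a \<in> N"
  proof -
    have "flip (flip (flip w e) c) a \<in> N" using e(3) by (simp add: flip_commute)
    from two_step[OF e(2) this pr(4)] show ?thesis using xe by (auto simp: flip_commute)
  qed
  show ?case
  proof (cases "e = l")
    case True
    then show ?thesis using wea by simp
  next
    case False
    have "\<exists>f\<in>sdiff w z. flip (flip w l) f \<in> N \<and> flip (flip w e) f \<in> N"
      using assms[unfolded forks_close_def, rule_format, of w z l e] pr e ew False by auto
    then obtain f where f: "f \<in> sdiff w z" "flip (flip w l) f \<in> N" "flip (flip w e) f \<in> N" by auto
    have fne: "f \<noteq> l" "f \<noteq> e"
      using no_square[of w l e] no_square[of w e l] pr e f False by (auto simp: flip_commute)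
    have wle: "flip (flip w l) e \<notin> N"
      using no_square[of w l e] pr e False by auto
    \<comment> \<open>If the hexagon leaves \<open>w\<close> by \<open>e\<close> instead of
      \<open>l\<close>, the fork of \<open>e\<close> and \<open>l\<close> at \<open>w\<close> leads
      to \<open>?w\<close>, nearer to \<open>z\<close>. Its neighbour \<open>flip w e\<close> has
      the edge labelled \<open>a\<close>, so \<open>f\<close> takes the role of
      \<open>c\<close>.\<close>
    let ?w = "flip (flip w e) f"
    have wf: "flip w f \<notin> N" using no_square[of w e f] pr e f fne by auto
    have lw: "flip ?w l \<in> N"
      using two_step[of "flip (flip w l) f" l e] two_step[of "flip (flip w e) f" l e] f wf False
      by (auto simp: flip_commute)
    have dw: "sdiff ?w z = sdiff w z - {e, f}" using ew f fne by auto
    have cardw: "card (sdiff ?w z) < card (sdiff w z)"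
      by (rule psubset_card_mono[OF fin]) (use dw ew in blast)
    have "flip (flip ?w l) a \<in> N"
    proof (rule less.hyps[of ?w f l])
      show "flip ?w f \<in> N" using e by simp
      show "flip (flip ?w f) a \<in> N" using wea by simp
      show "f \<noteq> a" using f pr by auto
      show "l \<in> sdiff ?w z" using dw pr fne False by auto
      show "a \<notin> sdiff ?w z" using dw pr by auto
      show "f \<notin> sdiff ?w z" using dw by auto
    qed (use cardw f pr lw in auto)
    hence 1: "flip (flip (flip (flip w e) a) f) l \<in> N" by (simp add: flip_commute)
    \<comment> \<open>The edge obtained beyond \<open>?w\<close> is now brought back to
      \<open>flip w l\<close> by removing \<open>f\<close> and then \<open>e\<close>; each time the
      other candidate would complete a square.\<close>
    have "flip (flip (flip w e) a) f \<notin> N"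
      using no_square[of "flip w e" a f] e wea f pr(10) by auto
    hence 2: "flip (flip (flip w e) a) l \<in> N"
      using two_step[OF wea 1] fne by auto
    hence "flip (flip (flip w l) e) a \<in> N" by (simp add: flip_commute)
    from two_step[OF pr(9) this eca(2)] show ?thesis using wle by auto
  qed
qed

section \<open>Geodesics and the cuts they cross\<close>

lemma chain:
  assumes "p \<in> N" "q \<in> N"
  shows "\<exists>x. x 0 = p \<and> x (card (sdiff p q)) = q \<and>
    (\<forall>i\<le>card (sdiff p q). x i \<in> N \<and> sdiff p (x i) \<subseteq> sdiff p q \<and> card (sdiff p (x i)) = i) \<and>
    (\<forall>i<card (sdiff p q). \<exists>c. c \<in> sdiff p q \<and> x (Suc i) = flip (x i) c)"
  using assms
proof (induction "card (sdiff p q)" arbitrary: p)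
  case 0
  then have "p = q" using finite_diff by fastforce
  then show ?case using 0 by (intro exI[of _ "\<lambda>_. p"]) auto
next
  case (Suc m p)
  from Suc.hyps(2) have "p \<noteq> q" by auto
  then obtain c where c: "c \<in> sdiff p q" "flip p c \<in> N" using isometric Suc.prems by blast
  have d: "sdiff (flip p c) q = sdiff p q - {c}" using c(1) by auto
  have m: "m = card (sdiff (flip p c) q)"
    using Suc.hyps(2) c(1) finite_diff[OF Suc.prems] by (simp add: d)
  from Suc.hyps(1)[OF m c(2) Suc.prems(2)] obtain x where
    x: "x 0 = flip p c" "x m = q"
      "\<forall>i\<le>m. x i \<in> N \<and> sdiff (flip p c) (x i) \<subseteq> sdiff p q - {c} \<and> card (sdiff (flip p c) (x i)) = i"
      "\<forall>i<m. \<exists>e. e \<in> sdiff p q - {c} \<and> x (Suc i) = flip (x i) e"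
    unfolding m[symmetric] unfolding d by auto
  have s: "sdiff p (x i) = insert c (sdiff (flip p c) (x i))" "c \<notin> sdiff (flip p c) (x i)" if "i \<le> m" for i
  proof -
    show "c \<notin> sdiff (flip p c) (x i)" using x(3) that by blast
    thus "sdiff p (x i) = insert c (sdiff (flip p c) (x i))" by auto
  qed
  let ?y = "case_nat p x"
  show ?case
  proof (intro exI[of _ ?y] conjI allI impI)
    show "?y (card (sdiff p q)) = q" using Suc.hyps(2)[symmetric] x by simp
  next
    fix i assume i: "i \<le> card (sdiff p q)"
    have "?y i \<in> N \<and> sdiff p (?y i) \<subseteq> sdiff p q \<and> card (sdiff p (?y i)) = i"
    proof (cases i)
      case 0 then show ?thesis using Suc.prems by simp
    next
      case (Suc j)
      then have j: "j \<le> m" using i Suc.hyps(2) by simp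
      then have "finite (sdiff (flip p c) (x j))" using x(3) c finite_diff by blast
      then show ?thesis using Suc x(3)[rule_format, OF j] s[OF j] c by auto
    qed
    then show "?y i \<in> N" "sdiff p (?y i) \<subseteq> sdiff p q" "card (sdiff p (?y i)) = i" by auto
  next
    fix i assume i: "i < card (sdiff p q)"
    show "\<exists>e. e \<in> sdiff p q \<and> ?y (Suc i) = flip (?y i) e"
    proof (cases i)
      case 0 then show ?thesis using x c by auto
    next
      case (Suc j)
      then show ?thesis using x(4)[rule_format, of j] i Suc.hyps(2) by auto
    qed
  qed simp
qed

text \<open>A geodesic from \<open>p\<close> to \<open>q\<close> has to flip \<open>a\<close>
  somewhere; \<open>z\<close> is its last vertex before the \<open>a\<close>-cut, that is, before
  its edge labelled \<open>a\<close>.\<close>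

lemma crossing:
  assumes "p \<in> N" "q \<in> N" "a \<in> sdiff p q"
  shows "\<exists>z\<in>N. flip z a \<in> N \<and> a \<notin> sdiff p z \<and> sdiff p z \<subseteq> sdiff p q"
  using assms
proof (induction "card (sdiff p q)" arbitrary: p rule: less_induct)
  case (less p)
  then have "p \<noteq> q" by auto
  then obtain c where c: "c \<in> sdiff p q" "flip p c \<in> N" using isometric less by blast
  show ?case
  proof (cases "c = a")
    case True then show ?thesis using less c by (intro bexI[of _ p]) auto
  next
    case False
    have d: "sdiff (flip p c) q = sdiff p q - {c}" using c(1) by auto
    have m: "card (sdiff (flip p c) q) < card (sdiff p q)"
      unfolding d using c(1) finite_diff[OF less.prems(1,2)] by (meson card_Diff1_less)
    have "a \<in> sdiff (flip p c) q" using less.prems(3) False by auto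
    then obtain z where z: "z \<in> N" "flip z a \<in> N" "a \<notin> sdiff (flip p c) z"
        "sdiff (flip p c) z \<subseteq> sdiff p q - {c}"
      using less.hyps[OF m c(2) less.prems(2)] d by metis
    have "sdiff p z \<subseteq> insert c (sdiff (flip p c) z)" by auto
    then show ?thesis using z c False less.prems(3) by (intro bexI[of _ z]) auto
  qed
qed

end

section \<open>Convex cycles\<close>

lemma walk_Cons: "walk V E (x # xs) \<longleftrightarrow> x \<in> V \<and> (xs = [] \<or> E x (hd xs) \<and> walk V E xs)"
proof (cases xs)
  case Nil
  then show ?thesis by (simp add: walk_def)
next
  case (Cons y ys)
  then show ?thesis
    by (auto simp: walk_def nth_Cons split: nat.splits)
qed

text \<open>Finiteness is part of the conclusion because \<open>card\<close> of an infinite set is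
  0, which would make the bound empty.\<close>

lemma card_sdiff_walk:
  assumes "walk W F xs" "\<And>u v. F u v \<Longrightarrow> card (sdiff u v) = 1"
  shows "finite (sdiff (hd xs) (last xs)) \<and> Suc (card (sdiff (hd xs) (last xs))) \<le> length xs"
  using assms(1)
proof (induction xs)
  case Nil
  then show ?case by (simp add: walk_def)
next
  case (Cons x xs)
  show ?case
  proof (cases "xs = []")
    case True
    then show ?thesis by simp
  next
    case False
    then have F: "F x (hd xs)" "walk W F xs" using Cons.prems by (auto simp: walk_Cons)
    have c1: "card (sdiff x (hd xs)) = 1" using assms(2) F by blast
    hence f1: "finite (sdiff x (hd xs))" by (intro card_ge_0_finite) simp
    have sub: "sdiff x (last xs) \<subseteq> sdiff x (hd xs) \<union> sdiff (hd xs) (last xs)" by auto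
    have "finite (sdiff x (last xs))" using sub f1 Cons.IH F(2) by (meson finite_UnI finite_subset)
    moreover have "card (sdiff x (last xs)) \<le> card (sdiff x (hd xs)) + card (sdiff (hd xs) (last xs))"
      using card_mono[OF _ sub] f1 Cons.IH F(2) by (meson card_Un_le finite_UnI le_trans)
    ultimately show ?thesis using False Cons.IH[OF F(2)] c1 by simp
  qed
qed

text \<open>A walk that is as short as the Hamming distance allows never flips a coordinate twice.\<close>
lemma sdiff_subset_tight_walk:
  assumes "walk W F xs" "\<And>u v. F u v \<Longrightarrow> card (sdiff u v) = 1"
    and "length xs = Suc (card (sdiff (hd xs) (last xs)))" "w \<in> set xs"
  shows "sdiff (hd xs) w \<subseteq> sdiff (hd xs) (last xs)"
  using assms(1,3,4)
proof (induction xs)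
  case Nil
  then show ?case by simp
next
  case (Cons x xs)
  show ?case
  proof (cases "xs = [] \<or> w = x")
    case True
    then show ?thesis using Cons.prems by auto
  next
    case False
    then have F: "F x (hd xs)" "walk W F xs" and ne: "xs \<noteq> []" and w: "w \<in> set xs"
      using Cons.prems by (auto simp: walk_Cons)
    obtain c where "sdiff x (hd xs) = {c}"
      using assms(2)[OF F(1)] card_1_singletonE by metis
    then have c: "hd xs = flip x c" by (metis flip_eq_iff)
    note cw = card_sdiff_walk[OF F(2) assms(2)]
    have len: "length xs = card (sdiff x (last xs))" using Cons.prems(2) ne by simp
    have cin: "c \<in> sdiff x (last xs)"
    \<comment> \<open>Otherwise the first edge leads away from the end, and the remaining walk is
      too short to make up for it.\<close>
    proof (rule ccontr)
      assume "c \<notin> sdiff x (last xs)"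
      then have "sdiff (hd xs) (last xs) = insert c (sdiff x (last xs))" "c \<notin> sdiff x (last xs)"
        unfolding c by auto
      moreover from this have "finite (sdiff x (last xs))" using cw by simp
      ultimately show False using len cw by simp
    qed
    have d: "sdiff (hd xs) (last xs) = sdiff x (last xs) - {c}" unfolding c using cin by auto
    have "finite (sdiff x (last xs))" using cw unfolding d by simp
    then have "Suc (card (sdiff (hd xs) (last xs))) = card (sdiff x (last xs))"
      unfolding d using cin by (metis card.remove)
    then have "sdiff (hd xs) w \<subseteq> sdiff (hd xs) (last xs)"
      using Cons.IH[OF F(2) _ w] len by simp
    then have "sdiff (flip x c) w \<subseteq> sdiff x (last xs) - {c}" using d c by metis
    then have "sdiff x w \<subseteq> sdiff x (last xs)" using cin by auto
    then show ?thesis using ne by simp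
  qed
qed

lemma gdist_le: "walk V E xs \<Longrightarrow> gdist V E (hd xs) (last xs) \<le> length xs - 1"
  unfolding gdist_def by (rule Least_le) (auto simp: walk_def)

lemma gdist_attained:
  assumes "walk V E ys" "hd ys = u" "last ys = v"
  shows "\<exists>xs. shortest_path V E u v xs"
proof -
  have "\<exists>n xs. walk V E xs \<and> hd xs = u \<and> last xs = v \<and> length xs = Suc n"
    using assms by (intro exI[of _ "length ys - 1"] exI[of _ ys]) (auto simp: walk_def)
  from LeastI_ex[OF this] show ?thesis unfolding shortest_path_def gdist_def .
qed

lemma cube_adj_commute: "cube_adj N u v \<longleftrightarrow> cube_adj N v u"
  by (auto simp: cube_adj_def sdiff_commute)

lemma card_flip: "finite u \<Longrightarrow> card (flip u c) = (if c \<in> u then card u - 1 else Suc (card u))"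
  by (auto simp: flip_mem flip_notmem)

context isometric_family
begin

lemma gdist_eq:
  assumes "u \<in> N" "v \<in> N"
  shows "gdist N (cube_adj N) u v = card (sdiff u v)"
proof (rule antisym)
  let ?m = "card (sdiff u v)"
  obtain x where x: "x 0 = u" "x ?m = v" "\<forall>i\<le>?m. x i \<in> N"
      "\<forall>i<?m. \<exists>c. c \<in> sdiff u v \<and> x (Suc i) = flip (x i) c"
    using chain[OF assms] by blast
  have "walk N (cube_adj N) (map x [0..<Suc ?m])"
    unfolding walk_def using x(3,4)
    by (auto simp: cube_adj_iff_flip nth_append simp del: upt_Suc)
  moreover have "hd (map x [0..<Suc ?m]) = u" by (simp add: hd_map x del: upt_Suc)
  moreover have "last (map x [0..<Suc ?m]) = v" by (simp add: x)
  ultimately show "gdist N (cube_adj N) u v \<le> ?m" using gdist_le by fastforce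
  obtain xs where "shortest_path N (cube_adj N) u v xs"
    using gdist_attained[of N "cube_adj N"] \<open>walk _ _ _\<close> \<open>hd _ = u\<close> \<open>last _ = v\<close> by blast
  then show "?m \<le> gdist N (cube_adj N) u v"
    using card_sdiff_walk[of N "cube_adj N" xs] by (auto simp: shortest_path_def cube_adj_def)
qed

lemma sdiff_subset_shortest_path:
  assumes "shortest_path N (cube_adj N) u v xs" "w \<in> set xs"
  shows "sdiff u w \<subseteq> sdiff u v" "w \<in> N"
proof -
  have xs: "walk N (cube_adj N) xs" "hd xs = u" "last xs = v" "length xs = Suc (gdist N (cube_adj N) u v)"
    using assms(1) by (auto simp: shortest_path_def)
  then show "w \<in> N" using assms(2) by (auto simp: walk_def)
  have "u \<in> N" "v \<in> N" using xs by (auto simp: walk_def)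
  then have "length xs = Suc (card (sdiff u v))" using xs gdist_eq by simp
  then show "sdiff u w \<subseteq> sdiff u v"
    using sdiff_subset_tight_walk[OF xs(1), of w] assms(2) xs by (simp add: cube_adj_def)
qed

text \<open>Two such geodesics, one for each edge of a fork, become the two sides of the cycle in
  \<open>thin_interval\<close>.\<close>

lemma chain_through:
  assumes "u \<in> N" "v \<in> N" "c \<in> sdiff u v" "flip u c \<in> N"
  shows "\<exists>x. x 0 = u \<and> x (card (sdiff u v)) = v \<and>
    (\<forall>i\<le>card (sdiff u v). x i \<in> N \<and> sdiff u (x i) \<subseteq> sdiff u v \<and> card (sdiff u (x i)) = i \<and>
      (0 < i \<longrightarrow> c \<in> sdiff u (x i))) \<and>
    (\<forall>i<card (sdiff u v). cube_adj N (x i) (x (Suc i)))"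
proof -
  let ?m = "card (sdiff (flip u c) v)"
  have d: "sdiff (flip u c) v = sdiff u v - {c}" using assms(3) by auto
  have m: "card (sdiff u v) = Suc ?m"
    unfolding d by (rule card.remove[OF finite_diff[OF assms(1,2)] assms(3)])
  obtain x where x: "x 0 = flip u c" "x ?m = v"
      "\<forall>i\<le>?m. x i \<in> N \<and> sdiff (flip u c) (x i) \<subseteq> sdiff u v - {c} \<and> card (sdiff (flip u c) (x i)) = i"
      "\<forall>i<?m. \<exists>e. e \<in> sdiff u v - {c} \<and> x (Suc i) = flip (x i) e"
    using chain[OF assms(4,2)] unfolding d by blast
  have s: "sdiff u (x i) = insert c (sdiff (flip u c) (x i))" "c \<notin> sdiff (flip u c) (x i)" if "i \<le> ?m" for i
  proof -
    show "c \<notin> sdiff (flip u c) (x i)" using x(3) that by blast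
    thus "sdiff u (x i) = insert c (sdiff (flip u c) (x i))" by auto
  qed
  have fin: "finite (sdiff (flip u c) (x i))" if "i \<le> ?m" for i
    using finite_diff[OF assms(4)] x(3) that by blast
  have 1: "case_nat u x i \<in> N \<and> sdiff u (case_nat u x i) \<subseteq> sdiff u v \<and>
      card (sdiff u (case_nat u x i)) = i \<and> (0 < i \<longrightarrow> c \<in> sdiff u (case_nat u x i))"
    if i: "i \<le> card (sdiff u v)" for i
  proof (cases i)
    case 0 then show ?thesis using assms by simp
  next
    case (Suc j)
    then have j: "j \<le> ?m" using i m by simp
    then show ?thesis
      using Suc x(3)[rule_format, OF j] s[OF j] fin[OF j] assms(3) by auto
  qed
  have 2: "cube_adj N (case_nat u x i) (case_nat u x (Suc i))" if i: "i < card (sdiff u v)" for i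
  proof (cases i)
    case 0 then show ?thesis using x assms by (auto simp: cube_adj_iff_flip)
  next
    case (Suc j)
    then have j: "j < ?m" using i m by simp
    then show ?thesis using Suc x(3)[rule_format, of j] x(3)[rule_format, of "Suc j"]
        x(4)[rule_format, OF j] by (auto simp: cube_adj_iff_flip)
  qed
  show ?thesis
    by (rule exI[of _ "case_nat u x"]) (use 1 2 m x in auto)
qed

text \<open>Call a vertex of the interval of type 10 if its label set contains \<open>c\<close> but not \<open>d\<close>, and
  of type 01 in the opposite case. A geodesic between the two types passes through \<open>u\<close> or \<open>v\<close>, so
  the label sets of its ends are disjoint or cover \<open>sdiff u v\<close>. By counting, each type has only one vertex
  at each distance from \<open>u\<close>, and the interval is a convex cycle.\<close>
lemma thin_interval:
  assumes "u \<in> N" "v \<in> N" "c \<in> sdiff u v" "d \<in> sdiff u v" "c \<noteq> d" "flip u c \<in> N" "flip u d \<in> N"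
    and Q00: "\<And>w. w \<in> N \<Longrightarrow> sdiff u w \<subseteq> sdiff u v \<Longrightarrow> c \<notin> sdiff u w \<Longrightarrow> d \<notin> sdiff u w \<Longrightarrow> w = u"
    and Q11: "\<And>w. w \<in> N \<Longrightarrow> sdiff u w \<subseteq> sdiff u v \<Longrightarrow> c \<in> sdiff u w \<Longrightarrow> d \<in> sdiff u w \<Longrightarrow> w = v"
    and hex: "\<forall>cs. convex_cycle N (cube_adj N) cs \<longrightarrow> length cs = 6"
  shows "card (sdiff u v) = 3"
proof -
  define n where "n = card (sdiff u v)"
  have fuv: "finite (sdiff u v)" using finite_diff assms by blast
  have n2: "n \<ge> 2" unfolding n_def
    using card_mono[OF fuv, of "{c,d}"] assms by simp
  obtain x where x: "x 0 = u" "x n = v"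
    "\<And>i. i \<le> n \<Longrightarrow> x i \<in> N \<and> sdiff u (x i) \<subseteq> sdiff u v \<and> card (sdiff u (x i)) = i"
    "\<And>i. i \<le> n \<Longrightarrow> 0 < i \<Longrightarrow> c \<in> sdiff u (x i)"
    "\<And>i. i < n \<Longrightarrow> cube_adj N (x i) (x (Suc i))"
    using chain_through[OF assms(1-3,6)] unfolding n_def by metis
  obtain y where y: "y 0 = u" "y n = v"
    "\<And>i. i \<le> n \<Longrightarrow> y i \<in> N \<and> sdiff u (y i) \<subseteq> sdiff u v \<and> card (sdiff u (y i)) = i"
    "\<And>i. i \<le> n \<Longrightarrow> 0 < i \<Longrightarrow> d \<in> sdiff u (y i)"
    "\<And>i. i < n \<Longrightarrow> cube_adj N (y i) (y (Suc i))"
    using chain_through[OF assms(1,2,4,7)] unfolding n_def by metis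
  have xd: "d \<notin> sdiff u (x i)" if "i < n" for i
  proof (cases "i = 0")
    case False
    have "x i \<noteq> v" using x(3)[of i] that by (auto simp: n_def)
    then show ?thesis using Q11[of "x i"] x(3)[of i] x(4)[of i] that False by auto
  qed (use x(1) in simp)
  have yc: "c \<notin> sdiff u (y i)" if "i < n" for i
  proof (cases "i = 0")
    case False
    have "y i \<noteq> v" using y(3)[of i] that by (auto simp: n_def)
    then show ?thesis using Q11[of "y i"] y(3)[of i] y(4)[of i] that False by auto
  qed (use y(1) in simp)
  define I where "I = {w \<in> N. sdiff u w \<subseteq> sdiff u v}"
  have through: "sdiff u p \<inter> sdiff u q = {} \<or> sdiff u p \<union> sdiff u q = sdiff u v"
    if p: "p \<in> I" "c \<in> sdiff u p" "d \<notin> sdiff u p" and q: "q \<in> I" "c \<notin> sdiff u q" "d \<in> sdiff u q" for p q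
  proof -
    have cpq: "c \<in> sdiff p q" using p q by auto
    obtain z where z: "z \<in> N" "flip z c \<in> N" "c \<notin> sdiff p z" "sdiff p z \<subseteq> sdiff p q"
      using crossing[of p q c] p q cpq unfolding I_def by blast
    have zI: "sdiff u z \<subseteq> sdiff u v"
    proof
      fix e assume e: "e \<in> sdiff u z"
      show "e \<in> sdiff u v"
      proof (rule ccontr)
        assume "e \<notin> sdiff u v"
        then have "e \<notin> sdiff u p" "e \<notin> sdiff u q" using p q unfolding I_def by blast+
        then show False using e z(4) by auto
      qed
    qed
    have cz: "c \<in> sdiff u z" using z(3) p(2) by auto
    \<comment> \<open>\<open>z\<close> carries \<open>c\<close>. If it also carries
      \<open>d\<close>, it is \<open>v\<close>; if not, the next vertex \<open>flip z c\<close>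
      carries neither label and is \<open>u\<close>.\<close>
    show ?thesis
    proof (cases "d \<in> sdiff u z")
      case True
      then have "z = v" using Q11[OF z(1) zI cz] by simp
      then have *: "sdiff p v \<subseteq> sdiff p q" using z(4) by simp
      have "sdiff u v \<subseteq> sdiff u p \<union> sdiff u q"
      proof
        fix e assume "e \<in> sdiff u v"
        then show "e \<in> sdiff u p \<union> sdiff u q" using *[THEN subsetD, of e] by auto
      qed
      then show ?thesis using p q unfolding I_def by blast
    next
      case False
      have "sdiff u (flip z c) \<subseteq> sdiff u v" "c \<notin> sdiff u (flip z c)" "d \<notin> sdiff u (flip z c)"
        using zI cz False assms(3,5) by auto
      then have "flip z c = u" using Q00[OF z(2)] by simp
      then have "z = flip u c" by (metis flip_flip)
      then have *: "sdiff p (flip u c) \<subseteq> sdiff p q" using z(4) by simp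
      have "e \<notin> sdiff u q" if "e \<in> sdiff u p" for e
        using that *[THEN subsetD, of e] q(2) by auto
      then show ?thesis by blast
    qed
  qed
  \<comment> \<open>When the sizes add up to \<open>n\<close>, disjointness and covering imply each
    other.\<close>
  have compl: "A = sdiff u v - B" if "A \<subseteq> sdiff u v" "B \<subseteq> sdiff u v" "card A + card B = n"
    "A \<inter> B = {} \<or> A \<union> B = sdiff u v" for A B
  proof -
    have fA: "finite A" "finite B" using that fuv finite_subset by blast+
    have cu: "card A + card B = card (A \<union> B) + card (A \<inter> B)" using card_Un_Int fA by blast
    have "A \<inter> B = {} \<and> A \<union> B = sdiff u v"
    proof (cases "A \<inter> B = {}")
      case True
      then have "card (A \<union> B) = n" using cu that by simp
      then show ?thesis using True card_subset_eq[OF fuv, of "A \<union> B"] that n_def by blast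
    next
      case False
      then have eq: "A \<union> B = sdiff u v" using that by blast
      then have "card (A \<inter> B) = 0" using cu that(3) n_def by simp
      then show ?thesis using eq fA by simp
    qed
    then show ?thesis by blast
  qed
  have I_I: "x i \<in> I" "y i \<in> I" if "i \<le> n" for i using x(3) y(3) that unfolding I_def by blast+
  have level: "card (sdiff u w) \<le> n \<and> (w = x (card (sdiff u w)) \<or> w = y (card (sdiff u w)))"
    if w: "w \<in> I" for w
  proof -
    define i where "i = card (sdiff u w)"
    have wI: "sdiff u w \<subseteq> sdiff u v" "w \<in> N" using w by (auto simp: I_def)
    have i: "i \<le> n" unfolding i_def n_def using card_mono[OF fuv] wI by blast
    have "w = x i \<or> w = y i"
    proof (cases "w = u \<or> w = v")
      case True
      then show ?thesis using x(1,2) by (auto simp: i_def n_def)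
    next
      case False
      have i0: "i \<noteq> 0" using False finite_subset[OF wI(1) fuv] by (auto simp: i_def)
      have "i \<noteq> n"
        using False card_subset_eq[OF fuv wI(1)] by (auto simp: i_def n_def set_eq_iff)
      then have ii: "i < n" "0 < i" "n - i < n" "0 < n - i" "n - i \<le> n" using i i0 by auto
      show ?thesis
      proof (cases "c \<in> sdiff u w")
        case True
        then have dw: "d \<notin> sdiff u w" using Q11[OF wI(2,1)] False by blast
        \<comment> \<open>The label sets of \<open>w\<close> and \<open>x i\<close> are both
          complementary to that of \<open>y (n - i)\<close>, so they agree.\<close>
        have "A = sdiff u v - sdiff u (y (n - i))"
          if "A = sdiff u w \<or> A = sdiff u (x i)" for A
        proof (rule compl)
          show "A \<inter> sdiff u (y (n - i)) = {} \<or> A \<union> sdiff u (y (n - i)) = sdiff u v"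
            using that through[OF w True dw I_I(2) yc[of "n-i"] y(4)[of "n-i"]]
              through[OF I_I(1) x(4)[of i] xd[of i] I_I(2) yc[of "n-i"] y(4)[of "n-i"]] ii by auto
        qed (use that wI x(3)[of i] y(3)[of "n-i"] ii in \<open>auto simp: i_def[symmetric]\<close>)
        then have "sdiff u w = sdiff u (x i)" by blast
        then show ?thesis by (auto simp: set_eq_iff)
      next
        case cw: False
        then have dw: "d \<in> sdiff u w" using Q00[OF wI(2,1)] False by blast
        have "A = sdiff u v - sdiff u (x (n - i))"
          if "A = sdiff u w \<or> A = sdiff u (y i)" for A
        proof (rule compl)
          show "A \<inter> sdiff u (x (n - i)) = {} \<or> A \<union> sdiff u (x (n - i)) = sdiff u v"
            using that through[OF I_I(1) x(4)[of "n-i"] xd[of "n-i"] w cw dw]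
              through[OF I_I(1) x(4)[of "n-i"] xd[of "n-i"] I_I(2) yc[of i] y(4)[of i]] ii
            by (auto simp: Int_commute Un_commute)
        qed (use that wI y(3)[of i] x(3)[of "n-i"] ii in \<open>auto simp: i_def[symmetric]\<close>)
        then have "sdiff u w = sdiff u (y i)" by blast
        then show ?thesis by (auto simp: set_eq_iff)
      qed
    qed
    then show ?thesis using i by (simp add: i_def)
  qed
  \<comment> \<open>Up along \<open>x\<close> from \<open>u\<close> to \<open>v\<close>, then down
    along \<open>y\<close>. The chains share both ends, which leaves \<open>2 * n\<close>
    vertices.\<close>
  define h where "h i = (if i \<le> n then x i else y (2 * n - i))" for i
  define cs where "cs = map h [0..<2 * n]"
  have len: "length cs = 2 * n" by (simp add: cs_def)
  have nth: "cs ! i = h i" if "i < 2 * n" for i using that by (simp add: cs_def)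
  have hx: "h i = x i" if "i \<le> n" for i using that by (simp add: h_def)
  have hy: "h (2 * n - i) = y i" if "i \<le> n" for i
    using that x(2) y(2) by (cases "i = n") (auto simp: h_def)
  \<comment> \<open>The reduction matters for \<open>i = 0\<close> only, where the way down returns
    to \<open>u\<close>, the vertex with index 0.\<close>
  have hy0: "h ((2 * n - i) mod (2 * n)) = y i" if "i \<le> n" for i
    using that hy[of i] hx[of 0] x(1) y(1) n2 by (cases "i = 0") auto
  have hlev: "card (sdiff u (h i)) = (if i \<le> n then i else 2 * n - i)" if "i < 2 * n" for i
    using that x(3)[of i] y(3)[of "2*n-i"] by (auto simp: h_def)
  have "inj_on h {0..<2*n}"
  proof (rule inj_onI)
    fix i j assume ij: "i \<in> {0..<2*n}" "j \<in> {0..<2*n}" "h i = h j"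
    have *: False if "i \<le> n" "n < j" "j < 2*n" "h i = h j" for i j
    proof -
      have e: "i = 2*n - j" using hlev[of i] hlev[of j] that by simp
      then have "0 < i" "i < n" using that by auto
      moreover have "x i = y i" using that e by (simp add: h_def)
      ultimately show False using x(4)[of i] yc[of i] by simp
    qed
    have ij2: "i < 2*n" "j < 2*n" using ij by auto
    have eq: "card (sdiff u (h i)) = card (sdiff u (h j))" using ij(3) by (rule arg_cong)
    show "i = j"
    proof (cases "i \<le> n"; cases "j \<le> n")
      assume "i \<le> n" "j \<le> n"
      then show ?thesis using hlev[OF ij2(1)] hlev[OF ij2(2)] eq by (metis (full_types))
    next
      assume "\<not> i \<le> n" "\<not> j \<le> n"
      then have "2*n - i = 2*n - j" using hlev[OF ij2(1)] hlev[OF ij2(2)] eq by (metis (full_types))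
      then show ?thesis using ij2 by linarith
    next
      assume "i \<le> n" "\<not> j \<le> n"
      then show ?thesis using *[of i j] ij2 ij(3) by (meson not_le)
    next
      assume "\<not> i \<le> n" "j \<le> n"
      then show ?thesis using *[of j i] ij2 ij(3)[symmetric] by (meson not_le)
    qed
  qed
  then have dist: "distinct cs" by (simp add: cs_def distinct_map)
  have set_cs: "set cs = I"
  proof
    show "set cs \<subseteq> I" using I_I by (auto simp: cs_def h_def)
    show "I \<subseteq> set cs"
    proof
      fix w assume "w \<in> I"
      with level obtain i where i: "i \<le> n" "w = x i \<or> w = y i" by blast
      have "x i \<in> h ` {0..<2*n}" using hx[OF i(1)] i n2 by (intro image_eqI[of _ _ i]) auto
      moreover have "y i \<in> h ` {0..<2*n}"
        using hy0[OF i(1)] n2 by (intro image_eqI[of _ _ "(2*n-i) mod (2*n)"]) auto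
      ultimately show "w \<in> set cs" using i(2) by (auto simp: cs_def)
    qed
  qed
  have ce_sym: "cycle_edge cs p q \<Longrightarrow> cycle_edge cs q p" for p q
    by (auto simp: cycle_edge_def)
  have ce_x: "cycle_edge cs (x i) (x (Suc i))" if "i < n" for i
    unfolding cycle_edge_def len
    using that n2 by (intro exI[of _ i]) (auto simp: nth hx)
  have ce_y: "cycle_edge cs (y (Suc i)) (y i)" if "i < n" for i
  proof -
    have "2*n - Suc i + 1 = 2*n - i" using that by linarith
    then have "(2*n - Suc i + 1) mod (2*n) = (2*n - i) mod (2*n)" by (rule arg_cong)
    moreover have "cs ! (2*n - Suc i) = y (Suc i)" using that hy[of "Suc i"] nth by simp
    moreover have "cs ! ((2*n - i) mod (2*n)) = y i" using that hy0[of i] nth n2 by simp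
    ultimately show ?thesis unfolding cycle_edge_def len using that
      by (intro exI[of _ "2*n - Suc i"]) auto
  qed
  have edges: "cube_adj N (cs ! i) (cs ! ((i + 1) mod length cs))" if i: "i < length cs" for i
  proof (cases "i < n")
    case True
    then show ?thesis using x(5)[of i] by (simp add: len nth hx)
  next
    case False
    define j where "j = 2*n - Suc i"
    have j: "j < n" "i = 2*n - Suc j" using False i by (auto simp: j_def len)
    have "i + 1 = 2*n - j" using j by linarith
    then have "(i + 1) mod (2*n) = (2*n - j) mod (2*n)" by (rule arg_cong)
    moreover have "cs ! i = y (Suc j)" using j hy[of "Suc j"] nth by simp
    moreover have "cs ! ((2*n - j) mod (2*n)) = y j" using j hy0[of j] nth n2 by simp
    ultimately show ?thesis unfolding len using y(5)[OF j(1)] cube_adj_commute by metis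
  qed
  have up: "cycle_edge cs p q"
    if pq: "p \<in> I" "q \<in> I" "cube_adj N p q" "card (sdiff u q) = Suc (card (sdiff u p))" for p q
  proof -
    define i where "i = card (sdiff u p)"
    have i: "i < n" "p = x i \<or> p = y i" "q = x (Suc i) \<or> q = y (Suc i)"
      using level[OF pq(1)] level[OF pq(2)] pq(4) by (auto simp: i_def)
    have one: "card (sdiff p q) = 1" using pq(3) by (simp add: cube_adj_def)
    \<comment> \<open>An edge flips one label, so away from \<open>u\<close> and \<open>v\<close> it
      cannot change the type of a vertex and stays on one of the chains.\<close>
    have no: "\<not> (c \<in> sdiff p q \<and> d \<in> sdiff p q)"
    proof
      assume a: "c \<in> sdiff p q \<and> d \<in> sdiff p q"
      have "finite (sdiff p q)" using one card.infinite by fastforce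
      then have "card {c,d} \<le> card (sdiff p q)" using a by (intro card_mono) auto
      then show False using one assms(5) by simp
    qed
    show ?thesis
    proof (cases "i = 0 \<or> Suc i = n")
      case True
      then have "p = x i \<and> q = x (Suc i) \<or> p = y i \<and> q = y (Suc i)"
        using i x(1,2) y(1,2) by auto
      then show ?thesis using ce_x[OF i(1)] ce_y[OF i(1)] ce_sym by blast
    next
      case False
      then have ii: "0 < i" "i < n" "Suc i < n" "i \<le> n" "Suc i \<le> n" using i by auto
      have "p = x i \<and> q = x (Suc i) \<or> p = y i \<and> q = y (Suc i)"
        using i(2,3) no x(4)[of i] xd[of i] x(4)[of "Suc i"] xd[of "Suc i"]
          y(4)[of i] yc[of i] y(4)[of "Suc i"] yc[of "Suc i"] ii by auto
      then show ?thesis using ce_x[OF i(1)] ce_y[OF i(1)] ce_sym by blast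
    qed
  qed
  have ce: "cycle_edge cs p q" if pq: "p \<in> I" "q \<in> I" "cube_adj N p q" for p q
  proof -
    obtain e where e: "q = flip p e" using pq by (auto simp: cube_adj_iff_flip)
    have f: "finite (sdiff u p)" "finite (sdiff u q)" using pq finite_diff assms by (auto simp: I_def)
    have "card (sdiff u q) = Suc (card (sdiff u p)) \<or> card (sdiff u p) = Suc (card (sdiff u q))"
    proof (cases "e \<in> sdiff u p")
      case True
      then have "sdiff u p = insert e (sdiff u q)" "e \<notin> sdiff u q" unfolding e by auto
      then show ?thesis using f by simp
    next
      case False
      then have "sdiff u q = insert e (sdiff u p)" unfolding e by auto
      then show ?thesis using f False by simp
    qed
    then show ?thesis using up[OF pq] up[OF pq(2,1)] pq(3) cube_adj_commute ce_sym by blast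
  qed
  have "convex_cycle N (cube_adj N) cs"
    unfolding convex_cycle_def gcycle_def
  proof (intro conjI ballI allI impI)
    show "3 \<le> length cs" using n2 len by simp
    show "set cs \<subseteq> N" using set_cs by (auto simp: I_def)
  next
    fix p q xs assume p: "p \<in> set cs" "q \<in> set cs" and sp: "shortest_path N (cube_adj N) p q xs"
    show sub: "set xs \<subseteq> set cs"
    proof
      fix w assume w: "w \<in> set xs"
      note s = sdiff_subset_shortest_path[OF sp w]
      have "sdiff u w \<subseteq> sdiff u v"
      proof
        fix e assume e: "e \<in> sdiff u w"
        show "e \<in> sdiff u v"
        proof (rule ccontr)
          assume "e \<notin> sdiff u v"
          then have "e \<notin> sdiff u p" "e \<notin> sdiff u q" using p unfolding set_cs I_def by blast+
          then show False using e s(1) by auto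
        qed
      qed
      then show "w \<in> set cs" using s(2) by (simp add: set_cs I_def)
    qed
    fix i assume i: "Suc i < length xs"
    then have "cube_adj N (xs ! i) (xs ! Suc i)" using sp by (auto simp: shortest_path_def walk_def)
    moreover have "xs ! i \<in> I" "xs ! Suc i \<in> I" using sub i unfolding set_cs by auto
    ultimately show "cycle_edge cs (xs ! i) (xs ! Suc i)" using ce by blast
  qed (use dist edges in auto)
  then show ?thesis using hex len n_def by simp
qed

text \<open>An inner vertex of the interval carrying both \<open>c\<close> and \<open>d\<close> is a
  nearer end for the fork. One carrying neither allows a fork at \<open>v\<close> to be closed, and
  \<open>zone_step\<close> brings the outcome back to \<open>u\<close>. Without either kind the
  interval is thin, and its length 3 leaves a single candidate for the closing label.\<close>

lemma forks_close_all:
  assumes hex: "\<forall>cs. convex_cycle N (cube_adj N) cs \<longrightarrow> length cs = 6"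
  shows "forks_close N n"
proof (induction n rule: less_induct)
  case (less n)
  show ?case
    unfolding forks_close_def
  proof (intro allI impI, elim conjE)
    fix u v c d
    assume uv: "u \<in> N" "v \<in> N" "card (sdiff u v) \<le> n" "c \<in> sdiff u v" "d \<in> sdiff u v" "c \<noteq> d"
      "flip u c \<in> N" "flip u d \<in> N"
    have fuv: "finite (sdiff u v)" using uv finite_diff by blast
    have IH: "\<exists>e\<in>sdiff p q. flip (flip p c) e \<in> N \<and> flip (flip p d) e \<in> N"
      if "p \<in> N" "q \<in> N" "sdiff p q \<subset> sdiff u v" "c \<in> sdiff p q" "d \<in> sdiff p q"
        "flip p c \<in> N" "flip p d \<in> N" for p q
    proof -
      have "card (sdiff p q) < n" using psubset_card_mono[OF fuv that(3)] uv(3) by simp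
      then show ?thesis
        using less[unfolded forks_close_def, rule_format, of "card (sdiff p q)" p q c d] that uv(6) by auto
    qed
    have FC: "forks_close N (n - 1)"
      using less[of "n - 1"] uv card_gt_0_iff[of "sdiff u v"] fuv by fastforce
    show "\<exists>e\<in>sdiff u v. flip (flip u c) e \<in> N \<and> flip (flip u d) e \<in> N"
    proof (cases "\<exists>w\<in>N. sdiff u w \<subseteq> sdiff u v \<and> c \<in> sdiff u w \<and> d \<in> sdiff u w \<and> w \<noteq> v")
      case True
      then obtain w where w: "w \<in> N" "sdiff u w \<subseteq> sdiff u v" "c \<in> sdiff u w" "d \<in> sdiff u w" "w \<noteq> v"
        by blast
      have "sdiff u w \<noteq> sdiff u v" using w(5) by (auto simp: set_eq_iff)
      then show ?thesis using IH[of u w] w uv by blast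
    next
      case False
      then have Q11: "w = v" if "w \<in> N" "sdiff u w \<subseteq> sdiff u v" "c \<in> sdiff u w" "d \<in> sdiff u w" for w
        using that by blast
      \<comment> \<open>A geodesic from \<open>flip u a\<close> to \<open>v\<close> never flips
        \<open>a\<close> back, so right after flipping \<open>b\<close> it carries both labels and
        can only be at \<open>v\<close>. The result is a fork at \<open>v\<close> towards
        \<open>u\<close>.\<close>
      have vlab: "flip v b \<in> N"
        if ab: "a \<in> sdiff u v" "b \<in> sdiff u v" "a \<noteq> b" "flip u a \<in> N" "{a, b} = {c, d}" for a b
      proof -
        have "b \<in> sdiff (flip u a) v" using ab by auto
        then obtain z where z: "z \<in> N" "flip z b \<in> N" "b \<notin> sdiff (flip u a) z"
            "sdiff (flip u a) z \<subseteq> sdiff (flip u a) v"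
          using crossing[OF ab(4) uv(2)] by blast
        have a: "a \<notin> sdiff (flip u a) z" using z(4) ab by auto
        have "sdiff u z = insert a (sdiff (flip u a) z)" using a by auto
        then have "sdiff u z \<subseteq> sdiff u v" using z(4) ab by auto
        then have "sdiff u (flip z b) \<subseteq> sdiff u v" "a \<in> sdiff u (flip z b)" "b \<in> sdiff u (flip z b)"
          using z(3) ab a by auto
        then have "flip z b = v" using Q11[OF z(2)] ab(5) by (auto simp: doubleton_eq_iff)
        then show ?thesis using z(1) by (metis flip_flip)
      qed
      have vd: "flip v d \<in> N" using vlab[of c d] uv by auto
      have vc: "flip v c \<in> N" using vlab[of d c] uv by auto
      show ?thesis
      proof (cases "\<exists>w\<in>N. sdiff u w \<subseteq> sdiff u v \<and> c \<notin> sdiff u w \<and> d \<notin> sdiff u w \<and> w \<noteq> u")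
        case True
        then obtain w where w: "w \<in> N" "sdiff u w \<subseteq> sdiff u v" "c \<notin> sdiff u w" "d \<notin> sdiff u w" "w \<noteq> u"
          by blast
        have vw: "sdiff v w = sdiff u v - sdiff u w" using w(2) by auto
        have "sdiff u w \<noteq> {}" using w(5) by simp
        then have "sdiff v w \<subset> sdiff u v" using w(2) vw by blast
        then obtain g where g: "g \<in> sdiff v w" "flip (flip v c) g \<in> N" "flip (flip v d) g \<in> N"
          using IH[of v w] uv w vc vd vw by blast
        have guv: "g \<in> sdiff u v" using g vw by blast
        have vcd: "flip (flip v c) d \<notin> N"
          using no_square[OF uv(2) vc vd] uv(6) by blast
        have gne: "g \<noteq> c" "g \<noteq> d" using g vcd by (auto simp: flip_commute)
        have vg: "flip v g \<notin> N" using no_square[OF uv(2) vc, of g] g(2) gne by blast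
        \<comment> \<open>The vertex opposite to \<open>v\<close> in the hexagon at
          \<open>v\<close>. It is three labels nearer to \<open>u\<close>, and \<open>c\<close> and
          \<open>d\<close> are labels at \<open>Q\<close> too: these edges are the targets for those
          at \<open>u\<close>.\<close>
        define Q where "Q = flip (flip (flip v c) d) g"
        have Qc: "flip Q c = flip (flip v d) g" and Qd: "flip Q d = flip (flip v c) g"
          unfolding Q_def by auto
        have QN: "Q \<in> N"
        proof -
          have "flip (flip (flip (flip v c) g) c) d \<in> N" using g(3) by (simp add: flip_commute)
          from two_step[OF g(2) this uv(6)] show ?thesis using vg by (auto simp: Q_def flip_commute)
        qed
        have uQ: "sdiff u Q = sdiff u v - {c, d, g}"
          unfolding Q_def using uv(4-6) guv gne by auto
        have card_uQ: "card (sdiff u Q) + 3 \<le> n"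
        proof -
          have "{c, d, g} \<subseteq> sdiff u v" using uv guv by auto
          moreover have "card {c, d, g} = 3" using gne uv(6) by simp
          ultimately have "card (sdiff u v) = card (sdiff u Q) + 3"
            unfolding uQ using card_mono[OF fuv, of "{c, d, g}"] card_Diff_subset[of "{c, d, g}" "sdiff u v"] by simp
          then show ?thesis using uv(3) by simp
        qed
        show ?thesis
        proof (cases "Q = u")
          case True
          then have "flip (flip u c) g = flip v d" "flip (flip u d) g = flip v c" using Qc Qd by simp_all
          then show ?thesis using vc vd guv by (intro bexI[of _ g]) simp_all
        next
          case False
          then obtain r where r: "r \<in> sdiff u Q" "flip u r \<in> N" using isometric[OF uv(1) QN] by blast
          have rne: "r \<noteq> c" "r \<noteq> d" using r uQ by auto
          have rc: "flip (flip u r) c \<notin> N" and rd: "flip (flip u r) d \<notin> N"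
            using no_square[OF uv(1) r(2) uv(7)] no_square[OF uv(1) r(2) uv(8)] rne by blast+
          have wQ: "sdiff (flip u r) Q = sdiff u Q - {r}" using r by auto
          \<comment> \<open>Were \<open>flip u r\<close> equal to \<open>Q\<close>, its edge
            labelled \<open>c\<close> would complete a square at \<open>u\<close>; hence there is a
            second step \<open>l\<close> towards \<open>Q\<close>.\<close>
          have "flip u r \<noteq> Q" using rc Qc g by auto
          then obtain l where l: "l \<in> sdiff (flip u r) Q" "flip (flip u r) l \<in> N"
            using isometric[OF r(2) QN] by blast
          have luQ: "l \<in> sdiff u Q" "l \<noteq> r" using l wQ by auto
          have lne: "l \<noteq> c" "l \<noteq> d" "l \<in> sdiff u v" using luQ uQ by auto
          have cw: "card (sdiff (flip u r) Q) + 2 \<le> n - 1"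
            using card_uQ card_mono[of "sdiff u Q" "sdiff (flip u r) Q"] wQ finite_diff[OF uv(1) QN]
            by auto
          \<comment> \<open>The choice of \<open>l\<close> does not depend on \<open>a\<close>, so
            the same \<open>l\<close> serves \<open>c\<close> and \<open>d\<close> and closes the
            fork.\<close>
          have step: "flip (flip u a) l \<in> N"
            if a: "a \<noteq> r" "a \<noteq> l" "flip u a \<in> N" "flip Q a \<in> N" "a \<notin> sdiff u Q" for a
          proof -
            have "flip (flip (flip u r) l) a \<in> N"
              by (rule zone_step[OF FC, of "flip u r" r Q]) (use a r l cw wQ QN uv in auto)
            then have "flip (flip (flip u a) r) l \<in> N" by (simp add: flip_commute)
            from two_step[OF a(3) this luQ(2)[symmetric]] show ?thesis
              using no_square[OF uv(1) a(3) r(2)] a(1) by blast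
          qed
          have "flip (flip u c) l \<in> N" "flip (flip u d) l \<in> N"
            using step[of c] step[of d] rne lne uv g Qc Qd uQ by auto
          then show ?thesis using lne by blast
        qed
      next
        case False
        then have "card (sdiff u v) = 3"
          using thin_interval[OF uv(1,2,4,5,6,7,8) _ Q11 hex] by blast
        then have "card (sdiff u v - {c, d}) = 1" using fuv uv by (simp add: card_Diff_subset)
        then obtain e where e: "sdiff u v - {c, d} = {e}" by (rule card_1_singletonE)
        then have e2: "sdiff u v = {c, d, e}" "e \<noteq> c" "e \<noteq> d" using uv(4,5) by blast+
        have v: "v = flip (flip (flip u c) d) e"
        proof (rule set_eqI)
          fix t
          have "t \<in> sdiff u v \<longleftrightarrow> t = c \<or> t = d \<or> t = e" using e2(1) by blast
          then show "t \<in> v \<longleftrightarrow> t \<in> flip (flip (flip u c) d) e"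
            using e2(2,3) uv(6) unfolding mem_sdiff mem_flip by blast
        qed
        have "flip (flip u c) d \<notin> N" using no_square[OF uv(1,7,8)] uv(6) by blast
        moreover have "flip (flip u c) d \<in> N \<or> flip (flip u c) e \<in> N"
          using two_step[OF uv(7), of d e] uv(2) v e2(3) by simp
        moreover have "flip (flip u d) c \<in> N \<or> flip (flip u d) e \<in> N"
          using two_step[OF uv(8), of c e] uv(2) v e2(2) by (simp add: flip_commute)
        ultimately show ?thesis unfolding e2(1) using flip_commute[of u c d] by auto
      qed
    qed
  qed
qed

end

section \<open>Full vertices and the Doubled Odd graph\<close>

lemma sdiff_eq: "(A - B) \<union> (B - A) = sdiff A B"
  by auto

text \<open>Sets differing in one element are nested with consecutive sizes, so the condition on the
  parts is automatic and the graph is an induced subgraph of the hypercube.\<close>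

lemma dodd_E_iff:
  assumes "k \<ge> 1" "A \<in> dodd_V k" "B \<in> dodd_V k"
  shows "dodd_E k A B \<longleftrightarrow> card (sdiff A B) = 1"
proof
  have fin: "finite A" "finite B" using assms by (auto simp: dodd_V_def intro: finite_subset)
  have *: "card (sdiff A B) = 1" if "A \<subset> B" "card A = k - 1" "card B = k" "finite B" for A B :: "nat set"
  proof -
    have "sdiff A B = B - A" using that(1) by auto
    moreover have "finite A" using that finite_subset by blast
    ultimately show ?thesis using that assms(1) by (simp add: card_Diff_subset psubset_imp_subset)
  qed
  show "card (sdiff A B) = 1" if "dodd_E k A B"
    using that *[of A B] *[of B A] fin by (auto simp: dodd_E_def sdiff_commute)
  assume "card (sdiff A B) = 1"
  then obtain c where "sdiff A B = {c}" by (rule card_1_singletonE)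
  then have B: "B = flip A c" by (metis flip_eq_iff)
  have k: "card A = k - 1 \<or> card A = k" "card B = k - 1 \<or> card B = k" using assms by (auto simp: dodd_V_def)
  show "dodd_E k A B"
  proof (cases "c \<in> A")
    case True
    then have "B = A - {c}" using B by (simp add: flip_mem)
    moreover from this have "card A = Suc (card B)" using True fin by (metis card.remove)
    ultimately show ?thesis using True k assms by (auto simp: dodd_E_def)
  next
    case False
    then have "B = insert c A" using B by (simp add: flip_notmem)
    moreover from this have "card B = Suc (card A)" using False fin by simp
    ultimately show ?thesis using False k assms by (auto simp: dodd_E_def)
  qed
qed

text \<open>The local shape of a Doubled Odd graph: there the labels at a vertex \<open>x\<close>
  and the set \<open>M\<close> partition the ground set.\<close>

definition full :: "'b set set \<Rightarrow> 'b set \<Rightarrow> 'b set \<Rightarrow> bool" where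
  "full N x M \<longleftrightarrow> x \<in> N \<and> (\<forall>c\<in>labels N x. labels N (flip x c) - {c} = M)"

section \<open>Full vertices: existence and propagation\<close>

context isometric_family
begin

lemma finite_labels: "finite (labels N u)"
proof (rule inj_on_finite[OF _ _ finite_family])
  show "inj_on (flip u) (labels N u)" by (simp add: inj_on_def)
qed (auto simp: labels_def)

text \<open>Since \<open>z'\<close> lies beyond the cuts of \<open>f\<close>, \<open>l\<close> and
  \<open>a\<close>, a geodesic to it from \<open>flip (flip x f) l\<close> still crosses the
  \<open>a\<close>-cut. The crossing edge is the target along which \<open>zone_step\<close> carries
  the edge labelled \<open>a\<close> past \<open>f\<close> and \<open>l\<close>.\<close>

lemma far_label:
  assumes FC: "\<And>n. forks_close N n"
    and x: "x \<in> N" "flip x a \<in> N" "flip x f \<in> N" "f \<noteq> a" "flip (flip x f) l \<in> N" "l \<noteq> f" "l \<noteq> a"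
    and z': "z' \<in> N" "f \<in> sdiff x z'" "l \<in> sdiff x z'" "a \<in> sdiff x z'"
  shows "flip (flip x a) l \<in> N"
proof -
  let ?w = "flip x f" and ?y = "flip (flip x f) l"
  have yz': "sdiff ?y z' = sdiff x z' - {f, l}" using z' x(6) by auto
  then have "a \<in> sdiff ?y z'" using z' x by blast
  then obtain z where z: "z \<in> N" "flip z a \<in> N" "a \<notin> sdiff ?y z" "sdiff ?y z \<subseteq> sdiff x z' - {f, l}"
    using crossing[OF x(5) z'(1)] unfolding yz' by blast
  have l: "l \<notin> sdiff ?y z" and f: "f \<notin> sdiff ?y z" using z(4) by blast+
  have w: "l \<in> sdiff ?w z" "f \<notin> sdiff ?w z" "a \<notin> sdiff ?w z" using l f z(3) x(6,7) by auto
  have "flip ?y a \<in> N"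
    by (rule zone_step[OF FC x(3) _ w(2) x(4) _ z(1,2) w(1) x(5) w(3) order_refl])
      (use x in simp_all)
  then have "flip (flip (flip x a) f) l \<in> N" by (simp add: flip_commute)
  from two_step[OF x(2) this x(6)[symmetric]] show ?thesis
    using no_square[OF x(1,2,3)] x(4) by blast
qed

text \<open>Take an edge \<open>x\<close>, \<open>flip x a\<close> for which the side of \<open>x\<close> is a smallest halfspace. The side of
  any other label that avoids \<open>x\<close> then reaches across the \<open>a\<close>-cut.\<close>
lemma exists_full:
  assumes FC: "\<And>n. forks_close N n" and reg: "\<And>u. u \<in> N \<Longrightarrow> card (labels N u) = k"
    and edge: "p \<in> N" "flip p b \<in> N"
  shows "\<exists>x M. full N x M"
proof -
  define H where "H = (\<lambda>(x, a). {y \<in> N. a \<notin> sdiff x y})"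
  define P where "P = (\<lambda>(x, a). x \<in> N \<and> flip x a \<in> N)"
  have "P (p, b)" using edge by (simp add: P_def)
  from ex_has_least_nat[of P, OF this, of "\<lambda>q. card (H q)"] obtain x a where
    xa: "P (x, a)" "\<And>q. P q \<Longrightarrow> card (H (x, a)) \<le> card (H q)" by fastforce
  have x: "x \<in> N" "flip x a \<in> N" using xa(1) by (auto simp: P_def)
  have cross: "\<exists>z\<in>N. l \<notin> sdiff y z \<and> a \<in> sdiff x z"
    if y: "y \<in> N" "flip y l \<in> N" "l \<in> sdiff y x" for y l
  proof (rule ccontr)
    assume "\<not> ?thesis"
    \<comment> \<open>Without such a \<open>z\<close> the halfspace of \<open>y\<close> would lie
      inside that of \<open>x\<close>, and properly so because it misses \<open>x\<close>.\<close>
    then have "H (y, l) \<subseteq> H (x, a)" by (auto simp: H_def)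
    moreover have "x \<in> H (x, a)" "x \<notin> H (y, l)" using x y by (auto simp: H_def)
    ultimately have "H (y, l) \<subset> H (x, a)" by blast
    then have "card (H (y, l)) < card (H (x, a))"
      by (intro psubset_card_mono) (auto simp: H_def intro: finite_subset[OF _ finite_family])
    moreover have "P (y, l)" using y by (simp add: P_def)
    ultimately show False using xa(2) by fastforce
  qed
  have key: "flip (flip x a) l \<in> N \<and> l \<noteq> a"
    if c: "flip x c \<in> N" "c \<noteq> a" "flip (flip x c) l \<in> N" "l \<noteq> c" for c l
  proof -
    let ?w = "flip x c"
    have la: "l \<noteq> a" using no_square[OF x(1) c(1) x(2)] c by blast
    have "l \<in> sdiff (flip ?w l) x" using c(4) by auto
    then obtain z where z: "z \<in> N" "l \<notin> sdiff (flip ?w l) z" "a \<in> sdiff x z"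
      using cross[OF c(3), of l] c(1) flip_flip[of ?w l] by metis
    have lz: "l \<in> sdiff x z" "l \<in> sdiff ?w z" using z(2) c(4) by auto
    have goal: ?thesis if "flip (flip ?w l) a \<in> N"
    proof -
      have "flip (flip (flip x a) c) l \<in> N" using that by (simp add: flip_commute)
      from two_step[OF x(2) this c(4)[symmetric]] show ?thesis
        using no_square[OF x(1,2) c(1)] c(2) la by blast
    qed
    show ?thesis
    proof (cases "c \<in> sdiff x z")
      case True
      then show ?thesis using far_label[OF FC x c la z(1) _ lz(1) z(3)] la by blast
    next
      case False
      then have cz: "c \<in> sdiff ?w z" by auto
      \<comment> \<open>Here \<open>z\<close> and \<open>x\<close> are on the same side of the
        \<open>c\<close>-cut, so \<open>c\<close> and \<open>l\<close> form a fork at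
        \<open>?w\<close> towards \<open>z\<close>. Its closing label \<open>f\<close> either is
        \<open>a\<close> or replaces \<open>c\<close> as the first step from
        \<open>x\<close>.\<close>
      have "\<exists>f\<in>sdiff ?w z. flip (flip ?w c) f \<in> N \<and> flip (flip ?w l) f \<in> N"
        using FC[unfolded forks_close_def, rule_format, of ?w z "card (sdiff ?w z)" c l] c x z(1) cz lz(2)
        by simp
      then obtain f where f: "f \<in> sdiff ?w z" "flip x f \<in> N" "flip (flip ?w l) f \<in> N" by auto
      have fc: "f \<noteq> c" using f(3) no_square[of ?w l c] c x by auto
      have fl: "f \<noteq> l" using f(2) no_square[of ?w c l] c x by auto
      show ?thesis
      proof (cases "f = a")
        case True
        then show ?thesis using goal f by simp
      next
        case fa: False
        have "flip (flip (flip x f) c) l \<in> N" using f(3) by (simp add: flip_commute)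
        from two_step[OF f(2) this c(4)[symmetric]] have xfl: "flip (flip x f) l \<in> N"
          using no_square[OF x(1) f(2) c(1)] fc by blast
        have "f \<in> sdiff x z" using f(1) fc by auto
        then show ?thesis
          using far_label[OF FC x f(2) fa xfl fl[symmetric] la z(1) _ lz(1) z(3)] la by blast
      qed
    qed
  qed
  have "labels N (flip x c) - {c} = labels N (flip x a) - {a}" if c: "c \<in> labels N x" for c
  proof (cases "c = a")
    case False
    have "labels N (flip x c) - {c} \<subseteq> labels N (flip x a) - {a}"
      using key[of c] c False by (auto simp: labels_def)
    moreover have "card (labels N (flip y b) - {b}) = k - 1" if "y \<in> N" "flip y b \<in> N" for y b
      using that reg finite_labels by (simp add: labels_def)
    ultimately show ?thesis
      using card_subset_eq finite_labels x c by (metis (no_types, lifting) finite_Diff labels_def mem_Collect_eq)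
  qed simp
  then have "full N x (labels N (flip x a) - {a})" using x by (auto simp: full_def)
  then show ?thesis by blast
qed

lemma full_disjoint:
  assumes "full N x M" "labels N x \<noteq> {}"
  shows "M \<inter> labels N x = {}"
proof -
  have x: "x \<in> N" using assms by (simp add: full_def)
  obtain c where c: "flip x c \<in> N" using assms(2) by (auto simp: labels_def)
  have "e \<notin> labels N x" if "e \<in> M" for e
  proof
    assume "e \<in> labels N x"
    moreover have "e \<noteq> c" "flip (flip x c) e \<in> N" using that assms(1) c by (auto simp: full_def labels_def)
    ultimately show False using no_square[OF x c] by (auto simp: labels_def)
  qed
  then show ?thesis by blast
qed

text \<open>The two label sets swap roles. For \<open>e\<close> in \<open>M\<close> and a further
  label \<open>d\<close> at \<open>x\<close>, \<open>flip (flip x d) e\<close> exists because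
  \<open>M\<close> is common to all neighbours. It is at distance 2 from
  \<open>flip (flip x c) e\<close>, and \<open>flip x e\<close> would complete a square, so
  \<open>d\<close> is a label at \<open>flip (flip x c) e\<close>. Counting excludes other
  labels.\<close>

lemma full_neighbour:
  assumes reg: "\<And>u. u \<in> N \<Longrightarrow> card (labels N u) = k"
    and "full N x M" "c \<in> labels N x"
  shows "full N (flip x c) (labels N x - {c})" "labels N (flip x c) = insert c M"
proof -
  have x: "x \<in> N" and xc: "flip x c \<in> N" using assms by (auto simp: full_def labels_def)
  have M: "labels N (flip x d) - {d} = M" if "d \<in> labels N x" for d
    using that assms by (auto simp: full_def)
  have "c \<in> labels N (flip x c)" using x by (simp add: labels_def)
  then show L: "labels N (flip x c) = insert c M" using M[OF assms(3)] by blast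
  have "labels N (flip (flip x c) e) - {e} = labels N x - {c}" if e: "e \<in> labels N (flip x c)" for e
  proof (cases "e = c")
    case False
    then have eM: "e \<in> M" using e L by blast
    have xce: "flip (flip x c) e \<in> N" using e by (simp add: labels_def)
    have xe: "flip x e \<notin> N" using no_square[OF x xc _ xce] False by blast
    have "labels N x - {c} \<subseteq> labels N (flip (flip x c) e) - {e}"
    proof
      fix d assume d: "d \<in> labels N x - {c}"
      then have "flip (flip x d) e \<in> N" using M[of d] eM by (auto simp: labels_def)
      then have "flip (flip (flip (flip x c) e) c) d \<in> N" by (simp add: flip_commute)
      from two_step[OF xce this] d xe have "flip (flip (flip x c) e) d \<in> N"
        by (auto simp: flip_commute)
      moreover have "d \<noteq> e" using d xe by (auto simp: labels_def)
      ultimately show "d \<in> labels N (flip (flip x c) e) - {e}" by (simp add: labels_def)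
    qed
    moreover have "card (labels N x - {c}) = k - 1" using reg[OF x] assms(3) finite_labels by simp
    moreover have "e \<in> labels N (flip (flip x c) e)" using xc by (simp add: labels_def)
    then have "card (labels N (flip (flip x c) e) - {e}) = k - 1" using reg[OF xce] finite_labels by simp
    ultimately show ?thesis using card_subset_eq finite_labels by (metis finite_Diff)
  qed (use x in simp)
  then show "full N (flip x c) (labels N x - {c})" using xc by (simp add: full_def)
qed

text \<open>Along an edge labelled \<open>c\<close> the set \<open>F v\<close> changes by \<open>c\<close>; it equals alternately the labels at \<open>v\<close>
  and the common further labels of the neighbours of \<open>v\<close>.\<close>
lemma graph_iso_dodd:
  assumes FC: "\<And>n. forks_close N n" and reg: "\<And>u. u \<in> N \<Longrightarrow> card (labels N u) = k"
    and edge: "p \<in> N" "flip p b \<in> N"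
  shows "graph_iso N (cube_adj N) (dodd_V k) (dodd_E k)"
proof -
  obtain v0 M0 where f0: "full N v0 M0" using exists_full[OF FC reg edge] by blast
  have v0: "v0 \<in> N" using f0 by (simp add: full_def)
  have "labels N p \<noteq> {}" using edge by (auto simp: labels_def)
  then have k: "k \<ge> 1" using reg[OF edge(1)] finite_labels[of p] by (metis One_nat_def Suc_leI card_gt_0_iff)
  then have L0: "labels N v0 \<noteq> {}" using reg[OF v0] by auto
  define T where "T = labels N v0 \<union> M0"
  \<comment> \<open>A translation of the hypercube, chosen to send \<open>v0\<close> to
    \<open>M0\<close>; it preserves differences and hence labels.\<close>
  define F where "F v = sdiff M0 (sdiff v0 v)" for v
  have Fflip: "F (flip v c) = flip (F v) c" for v c by (auto simp: F_def)
  have FF: "sdiff (F u) (F v) = sdiff u v" for u v by (auto simp: F_def)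
  \<comment> \<open>The alternatives will be the part of size \<open>k\<close> and the part of size
    \<open>k - 1\<close>.\<close>
  define P where "P v \<longleftrightarrow> F v \<subseteq> T \<and> ((labels N v = F v \<and> full N v (T - F v)) \<or>
      (labels N v = T - F v \<and> full N v (F v)))" for v
  have step: "P (flip w c)" if w: "P w" "c \<in> labels N w" for w c
  proof -
    consider (1) "labels N w = F w" "full N w (T - F w)" | (2) "labels N w = T - F w" "full N w (F w)"
      using w(1) by (auto simp: P_def)
    then show ?thesis
    proof cases
      case 1
      have F: "F (flip w c) = F w - {c}" using w 1 by (simp add: Fflip flip_mem)
      have "full N (flip w c) (F w - {c})" "labels N (flip w c) = insert c (T - F w)"
        using full_neighbour[OF reg 1(2) w(2)] 1(1) by auto
      moreover have "insert c (T - F w) = T - (F w - {c})" using w 1 by (auto simp: P_def)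
      ultimately show ?thesis using w(1) unfolding P_def F by auto
    next
      case 2
      have F: "F (flip w c) = insert c (F w)" using w 2 by (simp add: Fflip flip_notmem)
      have "full N (flip w c) (T - F w - {c})" "labels N (flip w c) = insert c (F w)"
        using full_neighbour[OF reg 2(2) w(2)] 2(1) by auto
      moreover have "T - F w - {c} = T - insert c (F w)" by auto
      ultimately show ?thesis using w 2 unfolding P_def F by auto
    qed
  qed
  have F0: "F v0 = M0" by (auto simp: F_def)
  have P0: "P v0" unfolding P_def F0 using full_disjoint[OF f0 L0] f0 by (auto simp: T_def)
  have P: "P v" if "v \<in> N" for v
    using that
  proof (induction "card (sdiff v v0)" arbitrary: v rule: less_induct)
    case less
    show ?case
    proof (cases "v = v0")
      case False
      then obtain c where c: "c \<in> sdiff v v0" "flip v c \<in> N" using isometric less.prems v0 by blast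
      have "sdiff (flip v c) v0 = sdiff v v0 - {c}" using c by auto
      then have "card (sdiff (flip v c) v0) < card (sdiff v v0)"
        using c finite_diff[OF less.prems v0] by (metis card_Diff1_less)
      then have "P (flip v c)" using less.hyps c by blast
      then show ?thesis using step[of "flip v c" c] less.prems by (simp add: labels_def)
    qed (use P0 in simp)
  qed
  have fT: "finite T"
  proof -
    obtain c where "c \<in> labels N v0" using L0 by blast
    then have "M0 \<subseteq> labels N (flip v0 c)" using f0 by (auto simp: full_def)
    then show ?thesis using finite_labels finite_subset by (auto simp: T_def)
  qed
  have cM: "card M0 = k - 1"
  proof -
    obtain c where c: "c \<in> labels N v0" using L0 by blast
    then have "labels N (flip v0 c) - {c} = M0" using f0 by (auto simp: full_def)
    moreover have "c \<in> labels N (flip v0 c)" using v0 by (simp add: labels_def)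
    moreover have "flip v0 c \<in> N" using c by (simp add: labels_def)
    ultimately show ?thesis using reg finite_labels by (metis card_Diff_singleton)
  qed
  have cT: "card T = 2 * k - 1"
  proof -
    have "card T = card (labels N v0) + card M0"
      unfolding T_def using full_disjoint[OF f0 L0] fT by (intro card_Un_disjoint) (auto simp: T_def)
    then show ?thesis using reg[OF v0] cM k by simp
  qed
  have cF: "F v \<subseteq> T" "labels N v = F v \<and> card (F v) = k \<or> labels N v = T - F v \<and> card (F v) = k - 1"
    if v: "v \<in> N" for v
  proof -
    show sub: "F v \<subseteq> T" using P[OF v] by (simp add: P_def)
    have "card (T - F v) = card T - card (F v)" "card (F v) \<le> card T"
      using sub fT by (auto intro: card_Diff_subset card_mono finite_subset)
    then show "labels N v = F v \<and> card (F v) = k \<or> labels N v = T - F v \<and> card (F v) = k - 1"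
      using P[OF v] reg[OF v] cT k by (auto simp: P_def)
  qed
  define W where "W = {S. S \<subseteq> T \<and> (card S = k - 1 \<or> card S = k)}"
  have surj: "\<exists>v\<in>N. F v = S" if S: "S \<in> W" for S
  proof -
    have fS: "finite S" "S \<subseteq> T" "card S = k - 1 \<or> card S = k" using S fT finite_subset by (auto simp: W_def)
    \<comment> \<open>If the nearest \<open>F v\<close> missed \<open>S\<close>, a neighbour would
      be nearer: from \<open>k\<close> elements one outside \<open>S\<close> can be removed, to
      \<open>k - 1\<close> elements one of \<open>S\<close> can be added, and these moves are labels
      at \<open>v\<close>.\<close>
    obtain v where v: "v \<in> N" "\<And>w. w \<in> N \<Longrightarrow> card (sdiff (F v) S) \<le> card (sdiff (F w) S)"
      using ex_has_least_nat[of "\<lambda>v. v \<in> N" v0 "\<lambda>v. card (sdiff (F v) S)"] v0 by blast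
    have fF: "finite (F v)" using cF(1)[OF v(1)] fT finite_subset by blast
    have "F v = S"
    proof (rule ccontr)
      assume ne: "F v \<noteq> S"
      have "\<exists>c\<in>labels N v. c \<in> sdiff (F v) S"
        using cF(2)[OF v(1)]
      proof (elim disjE conjE)
        assume a: "labels N v = F v" "card (F v) = k"
        have "\<not> F v \<subseteq> S" using ne card_seteq[OF fS(1), of "F v"] a fS(3) by auto
        then show ?thesis using a by auto
      next
        assume a: "labels N v = T - F v" "card (F v) = k - 1"
        have "\<not> S \<subseteq> F v" using ne card_seteq[OF fF, of S] a fS(3) by auto
        then show ?thesis using a fS(2) by auto
      qed
      then obtain c where c: "c \<in> labels N v" "c \<in> sdiff (F v) S" by blast
      have "sdiff (F (flip v c)) S = sdiff (F v) S - {c}" unfolding Fflip using c(2) by auto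
      then have "card (sdiff (F (flip v c)) S) < card (sdiff (F v) S)"
        using c(2) finite_sdiff[OF fF fS(1)] by (metis card_Diff1_less)
      moreover have "flip v c \<in> N" using c by (simp add: labels_def)
      ultimately show False using v(2) by fastforce
    qed
    then show ?thesis using v by blast
  qed
  have injF: "inj_on F N"
  proof (rule inj_onI)
    fix u v assume "F u = F v"
    then show "u = v" using FF[of u v] by (metis sdiff_empty_iff)
  qed
  have "F v \<in> W" if "v \<in> N" for v using cF[OF that] unfolding W_def by blast
  then have FW: "F ` N = W" using surj by blast
  have "card T = card {1..<2 * k}" using cT by simp
  then obtain g where g: "bij_betw g T {1..<2 * k}" using fT finite_same_card_bij by blast
  have ig: "inj_on g T" using g by (simp add: bij_betw_def)
  have cg: "card (g ` S) = card S" if "S \<subseteq> T" for S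
    using that ig by (meson card_image inj_on_subset)
  have gW: "(`) g ` W = dodd_V k"
  proof
    show "(`) g ` W \<subseteq> dodd_V k" using cg g by (auto simp: W_def dodd_V_def bij_betw_def)
    show "dodd_V k \<subseteq> (`) g ` W"
    proof
      fix A assume A: "A \<in> dodd_V k"
      then have "A \<subseteq> g ` T" using g by (simp add: dodd_V_def bij_betw_def)
      then obtain S where S: "S \<subseteq> T" "A = g ` S" by (meson subset_imageE)
      then have "S \<in> W" using A cg[OF S(1)] by (simp add: dodd_V_def W_def)
      then show "A \<in> (`) g ` W" using S by blast
    qed
  qed
  have igW: "inj_on ((`) g) W"
    by (rule inj_onI) (use inj_on_image_eq_iff[OF ig] in \<open>auto simp: W_def\<close>)
  have sg: "sdiff (g ` A) (g ` B) = g ` sdiff A B" if "A \<subseteq> T" "B \<subseteq> T" for A B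
  proof -
    have "g ` (A - B) = g ` A - g ` B" "g ` (B - A) = g ` B - g ` A"
      by (rule inj_on_image_set_diff[OF ig]; use that in blast)+
    then show ?thesis unfolding sdiff_eq[symmetric] image_Un by simp
  qed
  let ?f = "\<lambda>v. g ` F v"
  have "bij_betw ?f N (dodd_V k)"
    using bij_betw_trans[of F N W "(`) g" "dodd_V k"] injF FW igW gW
    by (simp add: bij_betw_def comp_def)
  moreover have "cube_adj N u v \<longleftrightarrow> dodd_E k (?f u) (?f v)" if uv: "u \<in> N" "v \<in> N" for u v
  proof -
    have "?f u \<in> dodd_V k" "?f v \<in> dodd_V k" using gW FW uv by blast+
    then have "dodd_E k (?f u) (?f v) \<longleftrightarrow> card (g ` sdiff u v) = 1"
      using dodd_E_iff[OF k] sg[OF cF(1) cF(1)] uv FF by simp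
    moreover have "sdiff (F u) (F v) \<subseteq> T"
      using cF(1)[OF uv(1)] cF(1)[OF uv(2)] unfolding sdiff_eq[symmetric] by blast
    ultimately show ?thesis using cg uv by (simp add: cube_adj_def FF)
  qed
  ultimately show ?thesis unfolding graph_iso_def by blast
qed

end

section \<open>Transfer to partial cubes\<close>

lemma gdist_hcube_le:
  assumes "A \<in> hcube_V n" "B \<in> hcube_V n"
  shows "gdist (hcube_V n) (hcube_E n) A B \<le> card (sdiff A B)"
proof -
  have "\<exists>xs. walk (hcube_V n) (hcube_E n) xs \<and> hd xs = A \<and> last xs = B \<and> length xs = Suc (card (sdiff A B))"
    using assms
  proof (induction "card (sdiff A B)" arbitrary: A)
    have fin: "finite (sdiff A B)" if "A \<in> hcube_V n" "B \<in> hcube_V n" for A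
      using that by (auto simp: hcube_V_def intro!: finite_sdiff intro: finite_subset)
    case 0
    then have "A = B" using fin by fastforce
    then show ?case using 0 by (intro exI[of _ "[A]"]) (simp add: walk_def)
  next
    case (Suc m)
    have fin: "finite (sdiff A B)"
      using Suc.prems by (auto simp: hcube_V_def intro!: finite_sdiff intro: finite_subset)
    have "sdiff A B \<noteq> {}" using Suc.hyps(2) by (metis card.empty nat.distinct(1))
    then obtain c where c: "c \<in> sdiff A B" by blast
    have d: "sdiff (flip A c) B = sdiff A B - {c}" using c by auto
    have m: "m = card (sdiff (flip A c) B)" unfolding d using c fin Suc.hyps(2) by simp
    have V: "flip A c \<in> hcube_V n" using c Suc.prems by (auto simp: hcube_V_def)
    obtain xs where xs: "walk (hcube_V n) (hcube_E n) xs" "hd xs = flip A c" "last xs = B" "length xs = Suc m"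
      using Suc.hyps(1)[OF m V Suc.prems(2)] m by metis
    have "hcube_E n A (flip A c)" using V Suc.prems by (simp add: hcube_E_def sdiff_eq)
    then have "walk (hcube_V n) (hcube_E n) (A # xs)" using xs Suc.prems by (simp add: walk_Cons)
    moreover have "xs \<noteq> []" using xs by auto
    ultimately show ?case using xs Suc.hyps(2) by (intro exI[of _ "A # xs"]) simp
  qed
  then show ?thesis using gdist_le by fastforce
qed

lemma walk_map:
  assumes "walk W F xs" "\<And>x. x \<in> W \<Longrightarrow> g x \<in> V" "\<And>x y. x \<in> W \<Longrightarrow> y \<in> W \<Longrightarrow> F x y \<Longrightarrow> E (g x) (g y)"
  shows "walk V E (map g xs)"
proof -
  have "xs ! i \<in> W" if "i < length xs" for i using that assms(1) by (auto simp: walk_def)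
  then show ?thesis using assms by (auto simp: walk_def)
qed

lemma no_short_cycle: "girth V E = 6 \<Longrightarrow> gcycle V E cs \<Longrightarrow> 6 \<le> length cs"
  unfolding girth_def by (metis (mono_tags, lifting) Least_le)

lemma gcycle_3: "gcycle V E [a, b, c]" if "E a b" "E b c" "E c a" "distinct [a, b, c]" "set [a, b, c] \<subseteq> V"
  using that unfolding gcycle_def by (simp add: All_less_Suc)

lemma gcycle_4: "gcycle V E [a, b, c, d]"
  if "E a b" "E b c" "E c d" "E d a" "distinct [a, b, c, d]" "set [a, b, c, d] \<subseteq> V"
  using that unfolding gcycle_def by (simp add: All_less_Suc)

lemma gcycle_5: "gcycle V E [a, b, c, d, e]"
  if "E a b" "E b c" "E c d" "E d e" "E e a" "distinct [a, b, c, d, e]" "set [a, b, c, d, e] \<subseteq> V"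
  using that unfolding gcycle_def by (simp add: All_less_Suc)

lemma gcycle_6: "gcycle V E [a, b, c, d, e, f] \<longleftrightarrow>
  E a b \<and> E b c \<and> E c d \<and> E d e \<and> E e f \<and> E f a \<and> distinct [a, b, c, d, e, f] \<and> set [a, b, c, d, e, f] \<subseteq> V"
  unfolding gcycle_def by (simp add: All_less_Suc) blast

text \<open>The image is a subgraph of the hypercube that is not induced by definition. Isometry
  makes it induced: Hamming distance 1 forces graph distance 1, hence an edge. The girth turns into
  \<open>no_square\<close>.\<close>

lemma partial_cube_isometric_family:
  fixes V :: "'a set"
  assumes g: "graph V E" and fin: "finite V" and pc: "partial_cube V E" and girth: "girth V E = 6"
  shows "\<exists>f :: 'a \<Rightarrow> nat set. inj_on f V \<and> isometric_family (f ` V) \<and>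
    (\<forall>u\<in>V. \<forall>v\<in>V. E u v \<longleftrightarrow> cube_adj (f ` V) (f u) (f v))"
proof -
  define F where "F f = (\<lambda>a b. \<exists>u\<in>V. \<exists>v\<in>V. E u v \<and> a = f u \<and> b = f v)" for f :: "'a \<Rightarrow> nat set"
  have conn: "connected_graph V E" using pc by (simp add: partial_cube_def)
  obtain n f where inj: "inj_on f V" and sub: "f ` V \<subseteq> hcube_V n"
    and edge: "\<forall>u\<in>V. \<forall>v\<in>V. E u v \<longrightarrow> hcube_E n (f u) (f v)"
    and iso: "\<forall>a\<in>f ` V. \<forall>b\<in>f ` V. gdist (f ` V) (F f) a b = gdist (hcube_V n) (hcube_E n) a b"
    using pc unfolding partial_cube_def Let_def F_def[symmetric] by (elim exE conjE) (rule that)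
  define N where "N = f ` V"
  have F1: "card (sdiff a b) = 1" if "F f a b" for a b
    using that edge by (auto simp: F_def hcube_E_def sdiff_eq)
  have geo: "\<exists>xs. walk N (F f) xs \<and> hd xs = a \<and> last xs = b \<and> length xs = Suc (card (sdiff a b))"
    if ab: "a \<in> N" "b \<in> N" for a b
  proof -
    obtain u v where uv: "u \<in> V" "v \<in> V" "a = f u" "b = f v" using ab by (auto simp: N_def)
    obtain ys where ys: "walk V E ys" "hd ys = u" "last ys = v"
      using conn uv by (auto simp: connected_graph_def)
    have "walk N (F f) (map f ys)" using ys(1) by (rule walk_map) (auto simp: N_def F_def)
    moreover have "ys \<noteq> []" using ys by (simp add: walk_def)
    ultimately obtain xs where xs: "shortest_path N (F f) a b xs"
      using gdist_attained[of N "F f" "map f ys" a b] ys uv by (auto simp: hd_map last_map)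
    then have w: "walk N (F f) xs" "hd xs = a" "last xs = b" "length xs = Suc (gdist N (F f) a b)"
      by (auto simp: shortest_path_def)
    have "gdist N (F f) a b \<le> card (sdiff a b)"
      using gdist_hcube_le[of a n b] iso ab sub unfolding N_def by (metis subsetD)
    moreover have "Suc (card (sdiff a b)) \<le> length xs" using card_sdiff_walk[OF w(1) F1] w by simp
    ultimately show ?thesis using w by (intro exI[of _ xs]) simp
  qed
  have adj: "E u v \<longleftrightarrow> cube_adj N (f u) (f v)" if uv: "u \<in> V" "v \<in> V" for u v
  proof
    assume "E u v"
    then show "cube_adj N (f u) (f v)" using F1[of "f u" "f v"] uv by (auto simp: cube_adj_def N_def F_def)
  next
    assume "cube_adj N (f u) (f v)"
    then have a: "f u \<in> N" "f v \<in> N" "card (sdiff (f u) (f v)) = 1" by (auto simp: cube_adj_def)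
    then obtain xs where xs: "walk N (F f) xs" "hd xs = f u" "last xs = f v" "length xs = 2"
      using geo[OF a(1,2)] by auto
    then obtain x y where "xs = [x, y]" by (auto simp: length_Suc_conv numeral_2_eq_2)
    then have "F f (f u) (f v)" using xs by (auto simp: walk_Cons)
    then obtain u' v' where "u' \<in> V" "v' \<in> V" "E u' v'" "f u = f u'" "f v = f v'" unfolding F_def by blast
    then show "E u v" using inj_onD[OF inj] uv by metis
  qed
  have "isometric_family N"
  proof
    show "finite N" using fin by (simp add: N_def)
    show "finite u" if "u \<in> N" for u
      using that sub finite_subset[of u "{..<n}"] by (auto simp: N_def hcube_V_def)
  next
    fix a b assume ab: "a \<in> N" "b \<in> N" "a \<noteq> b"
    obtain xs where xs: "walk N (F f) xs" "hd xs = a" "last xs = b" "length xs = Suc (card (sdiff a b))"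
      using geo[OF ab(1,2)] by blast
    have "xs \<noteq> []" using xs by auto
    then obtain ys where ys: "xs = a # ys" using xs(2) by (cases xs) auto
    have ne: "ys \<noteq> []" using ys xs(3) ab(3) by auto
    then have F: "F f a (hd ys)" "walk N (F f) ys" using xs(1) unfolding ys by (simp_all add: walk_Cons)
    then have hN: "hd ys \<in> N" using ne by (auto simp: walk_def)
    obtain c where c: "sdiff a (hd ys) = {c}" using F1[OF F(1)] by (rule card_1_singletonE)
    \<comment> \<open>A walk of Hamming length wastes no step, so already its first edge flips a
      label of \<open>sdiff a b\<close>.\<close>
    have "sdiff a (hd ys) \<subseteq> sdiff a b"
      using sdiff_subset_tight_walk[OF xs(1) F1, of "hd ys"] xs ys ne by simp
    then have "c \<in> sdiff a b" using c by blast
    moreover have "flip a c \<in> N" using hN c flip_eq_iff by metis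
    ultimately show "\<exists>c\<in>sdiff a b. flip a c \<in> N" by blast
  next
    fix a c d assume a: "a \<in> N" "flip a c \<in> N" "flip a d \<in> N" "flip (flip a c) d \<in> N"
    show "c = d"
    proof (rule ccontr)
      assume cd: "c \<noteq> d"
      obtain w x y z where v: "w \<in> V" "x \<in> V" "y \<in> V" "z \<in> V"
        "a = f w" "flip a c = f x" "flip (flip a c) d = f y" "flip a d = f z"
        using a unfolding N_def by blast
      have "E w x" using adj[OF v(1,2)] cube_adj_flip[OF a(1,2)] v by simp
      moreover have "E x y" using adj[OF v(2,3)] cube_adj_flip[OF a(2,4)] v by simp
      moreover have "E z y" using adj[OF v(4,3)] cube_adj_flip[OF a(3), of c] a(4) v by (simp add: flip_commute)
      moreover have "E w z" using adj[OF v(1,4)] cube_adj_flip[OF a(1,3)] v by simp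
      moreover have "distinct [a, flip a c, flip (flip a c) d, flip a d]"
      proof -
        have "a \<noteq> flip (flip a c) d" using cd by (metis flip_flip flip_inject)
        moreover have "flip (flip a c) d \<noteq> flip a d" by (metis flip_commute flip_neq(1))
        ultimately show ?thesis using cd by simp
      qed
      then have "distinct (map f [w, x, y, z])"
        unfolding list.map v(5)[symmetric] v(6)[symmetric] v(7)[symmetric] v(8)[symmetric] .
      then have "distinct [w, x, y, z]" by (simp only: distinct_map)
      ultimately have "gcycle V E [w, x, y, z]"
        using g v by (intro gcycle_4) (auto simp: graph_def)
      then show False using no_short_cycle[OF girth] by fastforce
    qed
  qed
  then show ?thesis using inj adj unfolding N_def by blast
qed

text \<open>The inverse \<open>h\<close> is explicit because a geodesic of the target graph has to
  be pulled back before the convexity of \<open>cs\<close> applies to it.\<close>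

lemma convex_cycle_map:
  assumes gh: "\<And>x. x \<in> W \<Longrightarrow> g x \<in> V" "\<And>y. y \<in> V \<Longrightarrow> h y \<in> W" "\<And>x. x \<in> W \<Longrightarrow> h (g x) = x" "\<And>y. y \<in> V \<Longrightarrow> g (h y) = y"
    and E: "\<And>x y. x \<in> W \<Longrightarrow> y \<in> W \<Longrightarrow> F x y \<longleftrightarrow> E (g x) (g y)"
    and cs: "convex_cycle W F cs"
  shows "convex_cycle V E (map g cs)"
proof -
  have cyc: "gcycle W F cs" and sub: "set cs \<subseteq> W" using cs by (auto simp: convex_cycle_def gcycle_def)
  have E': "E x y \<Longrightarrow> F (h x) (h y)" if "x \<in> V" "y \<in> V" for x y using E[of "h x" "h y"] gh that by simp
  have wg: "walk V E (map g xs)" if "walk W F xs" for xs using that by (rule walk_map) (use gh E in auto)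
  have wh: "walk W F (map h xs)" if "walk V E xs" for xs using that by (rule walk_map) (use gh E' in auto)
  have dist: "gdist V E (g p) (g q) = gdist W F p q" if "p \<in> W" "q \<in> W" for p q
  proof -
    have "(\<exists>xs. walk V E xs \<and> hd xs = g p \<and> last xs = g q \<and> length xs = Suc n) \<longleftrightarrow>
      (\<exists>xs. walk W F xs \<and> hd xs = p \<and> last xs = q \<and> length xs = Suc n)" for n
    proof
      assume "\<exists>xs. walk V E xs \<and> hd xs = g p \<and> last xs = g q \<and> length xs = Suc n"
      then obtain xs where xs: "walk V E xs" "hd xs = g p" "last xs = g q" "length xs = Suc n" by blast
      then have "xs \<noteq> []" by auto
      then show "\<exists>xs. walk W F xs \<and> hd xs = p \<and> last xs = q \<and> length xs = Suc n"
        using xs wh that gh by (intro exI[of _ "map h xs"]) (simp add: hd_map last_map)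
    next
      assume "\<exists>xs. walk W F xs \<and> hd xs = p \<and> last xs = q \<and> length xs = Suc n"
      then obtain xs where xs: "walk W F xs" "hd xs = p" "last xs = q" "length xs = Suc n" by blast
      then have "xs \<noteq> []" by auto
      then show "\<exists>xs. walk V E xs \<and> hd xs = g p \<and> last xs = g q \<and> length xs = Suc n"
        using xs wg by (intro exI[of _ "map g xs"]) (simp add: hd_map last_map)
    qed
    then show ?thesis by (simp add: gdist_def)
  qed
  have ce: "cycle_edge (map g cs) (g x) (g y)" if "cycle_edge cs x y" for x y
    using that unfolding cycle_edge_def
    by (metis (no_types, lifting) length_map mod_less_divisor nth_map length_0_conv length_greater_0_conv less_nat_zero_code list.size(3))
  show ?thesis
    unfolding convex_cycle_def
  proof (intro conjI ballI allI impI)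
    have "inj_on g W" using gh(3) by (metis inj_onI)
    then have "distinct (map g cs)" using cyc sub by (auto simp: gcycle_def distinct_map intro: inj_on_subset)
    moreover have "E (map g cs ! i) (map g cs ! ((i + 1) mod length cs))" if "i < length cs" for i
    proof -
      have "(i + 1) mod length cs < length cs" using that by (intro mod_less_divisor) auto
      moreover from this have "cs ! i \<in> W" "cs ! ((i + 1) mod length cs) \<in> W" using that sub by auto
      moreover have "F (cs ! i) (cs ! ((i + 1) mod length cs))" using that cyc unfolding gcycle_def by blast
      ultimately show ?thesis using that E by simp
    qed
    ultimately show "gcycle V E (map g cs)" using cyc sub gh(1) by (auto simp: gcycle_def)
  next
    fix u v xs assume u: "u \<in> set (map g cs)" "v \<in> set (map g cs)" and sp: "shortest_path V E u v xs"
    obtain p q where p: "p \<in> set cs" "q \<in> set cs" "u = g p" "v = g q" using u by auto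
    have pW: "p \<in> W" "q \<in> W" using p sub by auto
    have xs: "walk V E xs" "hd xs = u" "last xs = v" "length xs = Suc (gdist W F p q)"
      using sp dist[OF pW] p by (auto simp: shortest_path_def)
    have ne: "xs \<noteq> []" using xs by auto
    have "shortest_path W F p q (map h xs)"
      using xs wh ne p pW gh by (simp add: shortest_path_def hd_map last_map)
    then have c: "set (map h xs) \<subseteq> set cs"
      "\<And>i. Suc i < length xs \<Longrightarrow> cycle_edge cs (map h xs ! i) (map h xs ! Suc i)"
      using cs p unfolding convex_cycle_def by fastforce+
    have xV: "set xs \<subseteq> V" using xs by (simp add: walk_def)
    show "set xs \<subseteq> set (map g cs)"
    proof
      fix x assume x: "x \<in> set xs"
      then have "h x \<in> set cs" "g (h x) = x" using c(1) xV gh by auto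
      then show "x \<in> set (map g cs)" by (metis image_eqI set_map)
    qed
    fix i assume i: "Suc i < length xs"
    have "xs ! i \<in> V" "xs ! Suc i \<in> V" using i xV by (meson Suc_lessD nth_mem subsetD)+
    then have "g (h (xs ! i)) = xs ! i" "g (h (xs ! Suc i)) = xs ! Suc i" by (simp_all add: gh(4))
    then show "cycle_edge (map g cs) (xs ! i) (xs ! Suc i)"
      using ce[OF c(2)[OF i]] i by simp
  qed
qed

lemma graph_iso_dodd_of_convex_cycles:
  fixes V :: "'a set"
  assumes g: "graph V E" and fin: "finite V" and reg: "regular V E k" and pc: "partial_cube V E"
    and girth: "girth V E = 6" and hex: "\<forall>cs. convex_cycle V E cs \<longrightarrow> length cs = 6"
  shows "graph_iso V E (dodd_V k) (dodd_E k)"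
proof -
  obtain f :: "'a \<Rightarrow> nat set" where f: "inj_on f V" "isometric_family (f ` V)"
    "\<And>u v. u \<in> V \<Longrightarrow> v \<in> V \<Longrightarrow> E u v \<longleftrightarrow> cube_adj (f ` V) (f u) (f v)"
    using partial_cube_isometric_family[OF g fin pc girth] by blast
  let ?N = "f ` V"
  interpret isometric_family ?N by (rule f(2))
  have "length cs = 6" if "convex_cycle ?N (cube_adj ?N) cs" for cs
  proof -
    have "convex_cycle V E (map (inv_into V f) cs)"
      by (rule convex_cycle_map[where h = f, OF _ _ _ _ _ that]) (use f in auto)
    then show ?thesis using hex by fastforce
  qed
  then have FC: "\<And>n. forks_close ?N n" by (intro forks_close_all) blast
  have reg': "card (labels ?N u) = k" if uN: "u \<in> ?N" for u
  proof -
    obtain v where v: "v \<in> V" "u = f v" using uN by blast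
    have "flip u ` labels ?N u = f ` {w \<in> V. E v w}"
    proof (intro equalityI subsetI)
      fix x assume "x \<in> flip u ` labels ?N u"
      then obtain c where c: "x = flip u c" "flip u c \<in> ?N" by (auto simp: labels_def)
      then obtain w where w: "w \<in> V" "x = f w" by blast
      then show "x \<in> f ` {w \<in> V. E v w}" using f(3)[OF v(1) w(1)] cube_adj_flip[OF uN c(2)] c v by auto
    next
      fix x assume "x \<in> f ` {w \<in> V. E v w}"
      then obtain w where w: "w \<in> V" "E v w" "x = f w" by blast
      then obtain c where c: "x = flip u c" using f(3)[OF v(1) w(1)] v(2) by (auto simp: cube_adj_iff_flip)
      then have "c \<in> labels ?N u" using w unfolding labels_def by blast
      then show "x \<in> flip u ` labels ?N u" using c by blast
    qed
    moreover have "card (flip u ` labels ?N u) = card (labels ?N u)"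
      by (rule card_image) (simp add: inj_on_def)
    moreover have "card (f ` {w \<in> V. E v w}) = card {w \<in> V. E v w}"
      by (rule card_image) (use f(1) in \<open>auto simp: inj_on_def\<close>)
    ultimately show ?thesis using reg v by (simp add: regular_def)
  qed
  \<comment> \<open>Girth 6 is not the default value 0, so a cycle exists; it supplies an edge to
    start from.\<close>
  obtain cs where cs: "gcycle V E cs" using girth by (auto simp: girth_def split: if_splits)
  then have "E (cs ! 0) (cs ! 1)" unfolding gcycle_def by (auto dest: spec[of _ 0])
  then obtain u v where uv: "u \<in> V" "v \<in> V" "E u v" using g by (auto simp: graph_def)
  then obtain c where "f v = flip (f u) c" using f(3) by (auto simp: cube_adj_iff_flip)
  then have "flip (f u) c \<in> ?N" using uv by (metis imageI)
  then have "graph_iso ?N (cube_adj ?N) (dodd_V k) (dodd_E k)"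
    using graph_iso_dodd[OF FC reg', of "f u" c] uv by blast
  then obtain h where h: "bij_betw h ?N (dodd_V k)"
    "\<And>a b. a \<in> ?N \<Longrightarrow> b \<in> ?N \<Longrightarrow> cube_adj ?N a b \<longleftrightarrow> dodd_E k (h a) (h b)"
    unfolding graph_iso_def by blast
  have "bij_betw (h \<circ> f) V (dodd_V k)"
    by (rule bij_betw_trans[OF inj_on_imp_bij_betw[OF f(1)] h(1)])
  then show ?thesis unfolding graph_iso_def using f(3) h(2) by (intro exI[of _ "h \<circ> f"]) auto
qed

section \<open>Three-paths and hexagons\<close>

lemma flip_in_dodd_V_iff:
  assumes "k \<ge> 1" "A \<in> dodd_V k"
  shows "flip A c \<in> dodd_V k \<longleftrightarrow>
    c \<in> {1..<2 * k} \<and> (card A = k - 1 \<and> c \<notin> A \<or> card A = k \<and> c \<in> A)"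
proof -
  have A: "finite A" "A \<subseteq> {1..<2 * k}" "card A = k - 1 \<or> card A = k"
    using assms by (auto simp: dodd_V_def intro: finite_subset)
  show ?thesis
  proof (cases "c \<in> A")
    case True
    then have "0 < card A" using A(1) card_gt_0_iff by blast
    then show ?thesis using True A assms(1) by (auto simp: flip_mem dodd_V_def)
  next
    case False
    then show ?thesis using A assms(1) by (auto simp: flip_notmem dodd_V_def)
  qed
qed

text \<open>Moves alternate between adding and removing an element. So \<open>a\<close> and
  \<open>c\<close> are flipped in the same direction, hence distinct, and repeating the labels
  \<open>a\<close>, \<open>b\<close>, \<open>c\<close> undoes each flip in a permitted direction and
  closes the hexagon.\<close>

lemma dodd_hexagon:
  assumes k: "k \<ge> 1"
    and A: "dodd_E k A0 A1" "dodd_E k A1 A2" "dodd_E k A2 A3" "A0 \<noteq> A2" "A1 \<noteq> A3"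
  shows "\<exists>A4 A5. gcycle (dodd_V k) (dodd_E k) [A0, A1, A2, A3, A4, A5]"
proof -
  have V: "A0 \<in> dodd_V k" "A1 \<in> dodd_V k" "A2 \<in> dodd_V k" "A3 \<in> dodd_V k"
    using A by (auto simp: dodd_E_def)
  have ex: "\<exists>c. B = flip A c" if "dodd_E k A B" for A B
  proof -
    have "A \<in> dodd_V k" "B \<in> dodd_V k" using that by (auto simp: dodd_E_def)
    then have "card (sdiff A B) = 1" using dodd_E_iff[OF k] that by blast
    then show ?thesis by (metis card_1_singletonE flip_eq_iff)
  qed
  obtain a b c where f: "A1 = flip A0 a" "A2 = flip A1 b" "A3 = flip A2 c"
    using ex[OF A(1)] ex[OF A(2)] ex[OF A(3)] by blast
  have ab: "a \<noteq> b" "b \<noteq> c" using A(4,5) f by auto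
  note m = flip_in_dodd_V_iff[OF k]
  have a: "a \<in> {1..<2 * k}" "card A0 = k - 1 \<and> a \<notin> A0 \<or> card A0 = k \<and> a \<in> A0"
    using m[OF V(1), of a] V(2) f by auto
  have b: "b \<in> {1..<2 * k}" "card A1 = k - 1 \<and> b \<notin> A1 \<or> card A1 = k \<and> b \<in> A1"
    using m[OF V(2), of b] V(3) f by auto
  have c: "c \<in> {1..<2 * k}" "card A2 = k - 1 \<and> c \<notin> A2 \<or> card A2 = k \<and> c \<in> A2"
    using m[OF V(3), of c] V(4) f by auto
  have k1: "k - 1 \<noteq> k" using k by simp
  have cards: "card (flip S e) = k \<longleftrightarrow> card S = k - 1"
    if "S \<in> dodd_V k" "flip S e \<in> dodd_V k" for S e
  proof -
    have "finite S" using that by (auto simp: dodd_V_def intro: finite_subset)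
    moreover have "card S = k - 1 \<and> e \<notin> S \<or> card S = k \<and> e \<in> S" using m[OF that(1)] that(2) by blast
    ultimately show ?thesis using k by (auto simp: card_flip)
  qed
  have c1: "card A1 = k \<longleftrightarrow> card A0 = k - 1" using cards[of A0 a] V f by simp
  have c2: "card A2 = k \<longleftrightarrow> card A1 = k - 1" using cards[of A1 b] V f by simp
  have c3: "card A3 = k \<longleftrightarrow> card A2 = k - 1" using cards[of A2 c] V f by simp
  have ac: "a \<noteq> c"
  proof
    assume "a = c"
    then have "a \<in> A2 \<longleftrightarrow> a \<notin> A0" using f ab by auto
    then show False using a(2) c(2) c1 c2 k1 \<open>a = c\<close> b(2) by auto
  qed
  let ?A4 = "flip A3 a" and ?A5 = "flip (flip A3 a) b"
  have a3: "a \<in> A3 \<longleftrightarrow> a \<notin> A0" using f ab ac by auto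
  have b3: "b \<in> ?A4 \<longleftrightarrow> b \<notin> A1" using f ab ac by auto
  have V4: "?A4 \<in> dodd_V k"
    unfolding m[OF V(4)] using a a3 b(2) c(2) c1 c2 c3 k1 V(4) by (auto simp: dodd_V_def)
  have c4: "card ?A4 = k \<longleftrightarrow> card A3 = k - 1" using cards[OF V(4) V4] .
  have V5: "?A5 \<in> dodd_V k"
  proof -
    have "card ?A4 = k - 1 \<or> card ?A4 = k" "card A3 = k - 1 \<or> card A3 = k"
      using V4 V(4) by (simp_all add: dodd_V_def)
    then have "card ?A4 = k \<and> card A1 = k - 1 \<or> card ?A4 = k - 1 \<and> card A1 = k"
      using b(2) c(2) c2 c3 c4 k1 by metis
    then show ?thesis unfolding m[OF V4] using b b3 k1 by metis
  qed
  have "sdiff ?A5 A0 = {c}" using f ab ac by auto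
  then have e: "dodd_E k ?A5 A0" "dodd_E k A3 ?A4" "dodd_E k ?A4 ?A5"
    using dodd_E_iff[OF k V5 V(1)] dodd_E_iff[OF k V(4) V4] dodd_E_iff[OF k V4 V5] by simp_all
  have d: "distinct [A0, A1, A2, A3, ?A4, ?A5]"
  proof -
    \<comment> \<open>The six vertices are told apart by their differences from
      \<open>A0\<close>.\<close>
    have "map (sdiff A0) [A0, A1, A2, A3, ?A4, ?A5] = [{}, {a}, {a, b}, {a, b, c}, {b, c}, {c}]"
      unfolding f list.map using ab ac by (simp add: sdiff_flip_left sdiff_flip_right) auto
    moreover have "distinct [{}, {a}, {a, b}, {a, b, c}, {b, c}, {c}]"
      using ab ac by (auto simp: set_eq_iff)
    ultimately show ?thesis by (metis distinct_map)
  qed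
  have "set [A0, A1, A2, A3, ?A4, ?A5] \<subseteq> dodd_V k" using V V4 V5 by simp
  then show ?thesis using A(1-3) e d unfolding gcycle_6 by blast
qed

lemma list_of_length_4:
  assumes "length xs = 4"
  obtains a b c d where "xs = [a, b, c, d]"
  using assms by (auto simp: length_Suc_conv numeral_eq_Suc)

lemma three_path_in_hexagon_of_graph_iso_dodd:
  assumes g: "graph V E" and fin: "finite V" and reg: "regular V E k"
    and iso: "graph_iso V E (dodd_V k) (dodd_E k)" and p: "gpath V E p" "length p = 4"
  shows "\<exists>cs. gcycle V E cs \<and> length cs = 6 \<and> path_in_cycle p cs"
proof -
  obtain f where f: "bij_betw f V (dodd_V k)"
    "\<And>u v. u \<in> V \<Longrightarrow> v \<in> V \<Longrightarrow> E u v \<longleftrightarrow> dodd_E k (f u) (f v)"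
    using iso unfolding graph_iso_def by blast
  obtain p0 p1 p2 p3 where pe: "p = [p0, p1, p2, p3]" using p(2) by (rule list_of_length_4)
  have pV: "p0 \<in> V" "p1 \<in> V" "p2 \<in> V" "p3 \<in> V" and pE: "E p0 p1" "E p1 p2" "E p2 p3"
    and pd: "p0 \<noteq> p2" "p1 \<noteq> p3"
    using p(1) unfolding pe gpath_def by (auto simp: walk_Cons)
  have "{u \<in> V. E p0 u} \<noteq> {}" using pE pV by blast
  then have "card {u \<in> V. E p0 u} \<noteq> 0" using fin by simp
  then have k: "k \<ge> 1" using reg pV by (auto simp: regular_def)
  have inj: "inj_on f V" using f(1) by (simp add: bij_betw_def)
  have "f p0 \<noteq> f p2" "f p1 \<noteq> f p3" using pd inj pV by (auto simp: inj_on_def)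
  then obtain A4 A5 where cyc: "gcycle (dodd_V k) (dodd_E k) [f p0, f p1, f p2, f p3, A4, A5]"
    using dodd_hexagon[OF k, of "f p0" "f p1" "f p2" "f p3"] f(2) pV pE by blast
  then have "A4 \<in> f ` V" "A5 \<in> f ` V" using f(1) by (auto simp: gcycle_6 bij_betw_def)
  then obtain p4 p5 where q: "p4 \<in> V" "A4 = f p4" "p5 \<in> V" "A5 = f p5" by blast
  have "distinct (map f [p0, p1, p2, p3, p4, p5])" using cyc q by (auto simp: gcycle_6)
  then have "distinct [p0, p1, p2, p3, p4, p5]" by (simp only: distinct_map)
  then have "gcycle V E [p0, p1, p2, p3, p4, p5]"
    using cyc q pV f(2) unfolding gcycle_6 by auto
  moreover have "path_in_cycle p [p0, p1, p2, p3, p4, p5]"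
    unfolding path_in_cycle_def pe by (auto intro: exI[of _ 0])
  ultimately show ?thesis by (intro exI[of _ "[p0, p1, p2, p3, p4, p5]"]) simp
qed

text \<open>Together with \<open>gcycle_rev\<close> this permits the assumption that a cycle
  containing a path begins with it.\<close>

lemma gcycle_rotate: "gcycle V E (rotate m cs)" if c: "gcycle V E cs"
proof -
  have "E (rotate m cs ! i) (rotate m cs ! ((i + 1) mod length cs))" if i: "i < length cs" for i
  proof -
    have l: "(i + 1) mod length cs < length cs" "(m + i) mod length cs < length cs"
      using i by (auto intro: mod_less_divisor)
    have "((m + i) mod length cs + 1) mod length cs = (m + (i + 1) mod length cs) mod length cs"
      by (simp add: mod_simps)
    then show ?thesis using c l i by (auto simp: gcycle_def nth_rotate)
  qed
  then show ?thesis using c by (simp add: gcycle_def)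
qed

lemma gcycle_rev: "gcycle V E (rev cs)" if c: "gcycle V E cs" and g: "graph V E"
proof -
  have "E (rev cs ! i) (rev cs ! ((i + 1) mod length cs))" if i: "i < length cs" for i
  proof -
    \<comment> \<open>The edge is traversed backwards: \<open>j\<close> is the index in
      \<open>cs\<close> of its second end, and \<open>j + 1\<close> modulo the length that of its
      first end, also where the cycle wraps around.\<close>
    define j where "j = length cs - 1 - (i + 1) mod length cs"
    have m: "(i + 1) mod length cs < length cs" using i by (auto intro: mod_less_divisor)
    have j: "j < length cs" using i by (auto simp: j_def)
    have r: "rev cs ! ((i + 1) mod length cs) = cs ! j"
      using m by (simp add: rev_nth j_def)
    have "(j + 1) mod length cs = length cs - 1 - i"
    proof (cases "i + 1 = length cs")
      case True
      then have "j + 1 = length cs" by (auto simp: j_def)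
      then show ?thesis using True by simp
    next
      case False
      then have "(i + 1) mod length cs = i + 1" using i by simp
      then have "j + 1 = length cs - 1 - i" using False i by (simp add: j_def)
      then show ?thesis using i by simp
    qed
    moreover have "E (cs ! j) (cs ! ((j + 1) mod length cs))" using c j by (simp add: gcycle_def)
    moreover have "rev cs ! i = cs ! (length cs - 1 - i)" using i by (simp add: rev_nth)
    ultimately show ?thesis using g r by (simp add: graph_def)
  qed
  then show ?thesis using c by (simp add: gcycle_def)
qed

lemma cycle_edge_nth:
  assumes "distinct cs" "i < length cs" "cycle_edge cs (cs ! i) w"
  shows "\<exists>j<length cs. w = cs ! j \<and> (j = (i + 1) mod length cs \<or> i = (j + 1) mod length cs)"
proof -
  have l: "(j + 1) mod length cs < length cs" for j
    using assms(2) by (intro mod_less_divisor) auto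
  show ?thesis
    using assms(3) unfolding cycle_edge_def
  proof (elim exE conjE disjE)
    fix j assume "j < length cs" "cs ! i = cs ! j" "w = cs ! ((j + 1) mod length cs)"
    then show ?thesis using assms nth_eq_iff_index_eq l by (metis (no_types, lifting))
  next
    fix j assume "j < length cs" "w = cs ! j" "cs ! i = cs ! ((j + 1) mod length cs)"
    then show ?thesis using assms nth_eq_iff_index_eq l by (metis (no_types, lifting))
  qed
qed

text \<open>A shorter connection would close a triangle, a 4-cycle or a 5-cycle with edges of the
  path, according to its length and whether it passes through \<open>b\<close> or
  \<open>c\<close>.\<close>

lemma gdist_eq_3:
  assumes g: "graph V E" and girth: "girth V E = 6"
    and E: "E a b" "E b c" "E c d" and ne: "a \<noteq> c" "b \<noteq> d" "a \<noteq> d"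
  shows "gdist V E a d = 3"
proof (rule antisym)
  have V: "a \<in> V" "b \<in> V" "c \<in> V" "d \<in> V" and sym: "\<And>x y. E x y \<Longrightarrow> E y x"
    and irr: "\<And>x y. E x y \<Longrightarrow> x \<noteq> y" and inV: "\<And>x y. E x y \<Longrightarrow> x \<in> V \<and> y \<in> V"
    using g E unfolding graph_def by blast+
  have w: "walk V E [a, b, c, d]" using V E by (simp add: walk_Cons)
  then show "gdist V E a d \<le> 3" using gdist_le[OF w] by simp
  obtain xs where xs: "walk V E xs" "hd xs = a" "last xs = d" "length xs = Suc (gdist V E a d)"
    using gdist_attained[OF w, of a d] by (auto simp: shortest_path_def)
  note short = no_short_cycle[OF girth]
  show "3 \<le> gdist V E a d"
  proof (rule ccontr)
    assume "\<not> 3 \<le> gdist V E a d"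
    then have "length xs = 1 \<or> length xs = 2 \<or> length xs = 3" using xs(4) by linarith
    then consider x where "xs = [x]" | x y where "xs = [x, y]" | x y z where "xs = [x, y, z]"
      by (auto simp: length_Suc_conv numeral_eq_Suc)
    then show False
    proof cases
      case 1
      then show False using xs ne by simp
    next
      case 2
      then have "E a d" using xs by (simp add: walk_Cons)
      then have "gcycle V E [a, b, c, d]" using E sym irr ne V by (intro gcycle_4) auto
      then show False using short by fastforce
    next
      case (3 x m z)
      then have m: "E a m" "E m d" using xs by (auto simp: walk_Cons)
      consider "m = b" | "m = c" | "m \<noteq> b" "m \<noteq> c" by blast
      then show False
      proof cases
        case 1
        then have "gcycle V E [b, c, d]" using E m sym irr ne V by (intro gcycle_3) auto
        then show False using short by fastforce
      next
        case 2
        then have "gcycle V E [a, b, c]" using E m sym irr ne V by (intro gcycle_3) auto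
        then show False using short by fastforce
      next
        case 3
        then have "gcycle V E [a, b, c, d, m]" using E m sym irr[OF E(1)] irr[OF E(2)] irr[OF E(3)] irr[OF m(1)] irr[OF m(2)] ne V inV[OF m(1)] by (intro gcycle_5) auto
        then show False using short by fastforce
      qed
    qed
  qed
qed

lemma convex_cycle_hexagon_of_three_paths:
  assumes g: "graph V E" and girth: "girth V E = 6"
    and paths: "\<forall>p. gpath V E p \<and> length p = 4 \<longrightarrow>
      (\<exists>cs. gcycle V E cs \<and> length cs = 6 \<and> path_in_cycle p cs)"
    and cs: "convex_cycle V E cs"
  shows "length cs = 6"
proof -
  have cyc: "gcycle V E cs" using cs by (simp add: convex_cycle_def)
  define l where "l = length cs"
  have l6: "6 \<le> l" using no_short_cycle[OF girth cyc] by (simp add: l_def)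
  have dist: "distinct cs" using cyc by (simp add: gcycle_def)
  define c where "c i = cs ! i" for i
  have cE: "E (c i) (c (Suc i))" if "Suc i < l" for i
    using cyc that unfolding gcycle_def c_def l_def by (metis Suc_eq_plus1 Suc_lessD mod_less)
  have cV: "c i \<in> V" if "i < l" for i using cyc that by (auto simp: gcycle_def c_def l_def)
  have ceq: "c i = c j \<longleftrightarrow> i = j" if "i < l" "j < l" for i j
    using that dist by (simp add: c_def l_def nth_eq_iff_index_eq)
  let ?p = "[c 0, c 1, c 2, c 3]"
  have e: "E (c 0) (c 1)" "E (c 1) (c 2)" "E (c 2) (c 3)"
    using cE[of 0] cE[of 1] cE[of 2] l6 by (simp_all add: numeral_eq_Suc)
  have "gpath V E ?p" unfolding gpath_def using e cV ceq l6 by (simp add: walk_Cons)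
  then obtain ds where ds: "gcycle V E ds" "length ds = 6" "path_in_cycle ?p ds"
    using paths by fastforce
  then obtain i where "take 4 (rotate i ds) = ?p \<or> take 4 (rotate i (rev ds)) = ?p"
  proof -
    have "length ?p = 4" by simp
    then show ?thesis using ds(3) that unfolding path_in_cycle_def by metis
  qed
  then obtain rs where rs: "gcycle V E rs" "length rs = 6" "take 4 rs = ?p"
    using gcycle_rotate gcycle_rev[OF ds(1) g] ds by (metis length_rev length_rotate)
  define ts where "ts = drop 4 rs"
  have "length ts = 2" using rs by (simp add: ts_def)
  then obtain z y where "ts = [z, y]" by (auto simp: length_Suc_conv numeral_2_eq_2)
  then have "rs = [c 0, c 1, c 2, c 3, z, y]" using rs(3) append_take_drop_id[of 4 rs] by (simp add: ts_def)
  then have hx: "E (c 3) z" "E z y" "E y (c 0)" "distinct [c 0, c 1, c 2, c 3, z, y]" "z \<in> V" "y \<in> V"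
    using rs(1) by (auto simp: gcycle_6)
  have sym: "\<And>x y. E x y \<Longrightarrow> E y x" using g by (auto simp: graph_def)
  have "gdist V E (c 0) (c 3) = 3"
    by (rule gdist_eq_3[OF g girth e]) (use ceq l6 in simp_all)
  then have "shortest_path V E (c 0) (c 3) [c 0, y, z, c 3]"
    using hx sym cV l6 by (simp add: shortest_path_def walk_Cons)
  moreover have "c 0 \<in> set cs" "c 3 \<in> set cs" using l6 by (auto simp: c_def l_def intro!: nth_mem)
  ultimately have ce: "cycle_edge cs ([c 0, y, z, c 3] ! i) ([c 0, y, z, c 3] ! Suc i)" if "Suc i < 4" for i
    using cs that unfolding convex_cycle_def by fastforce
  have "cycle_edge cs (c 0) y" "cycle_edge cs y z" "cycle_edge cs z (c 3)"
    using ce[of 0] ce[of 1] ce[of 2] by (simp_all add: numeral_eq_Suc)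
  moreover from this have "cycle_edge cs (c 3) z" by (auto simp: cycle_edge_def)
  ultimately have ce: "cycle_edge cs (cs ! 0) y" "cycle_edge cs (cs ! 3) z" "cycle_edge cs y z"
    by (simp_all add: c_def)
  have len: "0 < length cs" "3 < length cs" using l6 by (auto simp: l_def)
  obtain j where j: "j < l" "y = c j" "j = (0 + 1) mod l \<or> 0 = (j + 1) mod l"
    using cycle_edge_nth[OF dist len(1) ce(1)] unfolding c_def l_def by blast
  \<comment> \<open>On \<open>cs\<close> the neighbours of \<open>c 0\<close> are \<open>c 1\<close>
    and the last vertex, so \<open>y\<close> is the last one. Likewise \<open>z\<close> is
    \<open>c 4\<close>, and since \<open>y\<close> and \<open>z\<close> are adjacent on
    \<open>cs\<close>, the last index is 5.\<close>
  have "y \<noteq> c 1" using hx by auto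
  then have "(j + 1) mod l = 0" using j l6 by auto
  then have yj: "j + 1 = l" using j by (metis Suc_eq_plus1 Suc_lessI mod_less nat.distinct(1))
  obtain i where i: "i < l" "z = c i" "i = (3 + 1) mod l \<or> 3 = (i + 1) mod l"
    using cycle_edge_nth[OF dist len(2) ce(2)] unfolding c_def l_def by blast
  have "i = 4"
  proof (rule ccontr)
    assume "i \<noteq> 4"
    then have "3 = (i + 1) mod l" using i l6 by auto
    then have "i = 2" using i(1) l6 by (cases "i + 1 = l") auto
    then show False using i hx by auto
  qed
  obtain m where m: "m < l" "z = c m" "m = (j + 1) mod l \<or> j = (m + 1) mod l"
    using cycle_edge_nth[OF dist, of j z] ce(3) j(1,2) unfolding c_def l_def by blast
  have "m = 4" using m i \<open>i = 4\<close> ceq by auto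
  then have "j = 5" using m yj l6 by auto
  then show ?thesis using yj by (simp add: l_def)
qed

theorem theorem4p2:
  fixes V :: "'a set" and E :: "'a \<Rightarrow> 'a \<Rightarrow> bool" and k :: nat
  assumes "graph V E" and "finite V" and "regular V E k"
    and "partial_cube V E" and "girth V E = 6"
  shows "((\<forall>cs. convex_cycle V E cs \<longrightarrow> length cs = 6) \<longleftrightarrow>
           (\<forall>p. gpath V E p \<and> length p = 4 \<longrightarrow>
              (\<exists>cs. gcycle V E cs \<and> length cs = 6 \<and> path_in_cycle p cs)))
       \<and> ((\<forall>p. gpath V E p \<and> length p = 4 \<longrightarrow>
              (\<exists>cs. gcycle V E cs \<and> length cs = 6 \<and> path_in_cycle p cs)) \<longleftrightarrow>
           graph_iso V E (dodd_V k) (dodd_E k))"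
  using graph_iso_dodd_of_convex_cycles[OF assms]
    three_path_in_hexagon_of_graph_iso_dodd[OF assms(1-3)]
    convex_cycle_hexagon_of_three_paths[OF assms(1,5)]
  by blast

end
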